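(* Let $n$ and $k$ be positive integers and let $a\in\mathbb{C}$, $a\neq 0$. Consider the planar differential equation, written in the complex coordinate $z=x+iy$, \[ \dot z = iz + a\,(z\overline{z})^n z^{k+1}. \] The origin is a center of this equation, and its period function is monotonous decreasing. Moreover, the period function tends to $2\pi$ as the periodic orbits approach the origin, and tends to $\dfrac{2(k+n)\pi}{k+2n}$ as the periodic orbits approach the boundary of the period annulus.
   Context: The period annulus of a center is the largest punctured neighborhood of the center foliated by periodic orbits. The period function assigns to each periodic orbit in the period annulus its minimal period; it is considered as a function of a parameter that increases monotonically from the center to the outer boundary of the period annulus (e.g. the distance from the center of the intersection point of the orbit with a transversal ray emanating from the center). "Monotonous decreasing" refers to this parametrization. *)

theory Defs
  imports "HOL-Analysis.Analysis"
begin

definition ode_solution :: "(complex \<Rightarrow> complex) \<Rightarrow> (real \<Rightarrow> complex) \<Rightarrow> bool" where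
  "ode_solution f x \<longleftrightarrow> (\<forall>t. (x has_vector_derivative f (x t)) (at t))"

definition periodic_point :: "(complex \<Rightarrow> complex) \<Rightarrow> complex \<Rightarrow> bool" where
  "periodic_point f p \<longleftrightarrow> f p \<noteq> 0 \<and>
     (\<exists>x T. ode_solution f x \<and> x 0 = p \<and> T > 0 \<and> x T = p)"

definition period :: "(complex \<Rightarrow> complex) \<Rightarrow> complex \<Rightarrow> real" where
  "period f p = Inf {T. T > 0 \<and> (\<exists>x. ode_solution f x \<and> x 0 = p \<and> x T = p)}"

definition is_center :: "(complex \<Rightarrow> complex) \<Rightarrow> complex \<Rightarrow> bool" where
  "is_center f c \<longleftrightarrow> f c = 0 \<and> (\<exists>r>0. \<forall>p \<in> ball c r - {c}. periodic_point f p)"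

definition period_annulus :: "(complex \<Rightarrow> complex) \<Rightarrow> complex \<Rightarrow> complex set" where
  "period_annulus f c = \<Union> {U. c \<notin> U \<and> open (insert c U) \<and> connected (insert c U) \<and>
                                 (\<forall>p\<in>U. periodic_point f p)}"

text \<open>Filter "approaching the outer boundary" of a period annulus \<open>U\<close> of the center \<open>c\<close>:
  eventually leaving every compact subset of \<open>U \<union> {c}\<close>.\<close>
definition approach_outer_boundary :: "complex set \<Rightarrow> complex \<Rightarrow> complex filter" where
  "approach_outer_boundary U c = (INF K\<in>{K. compact K \<and> K \<subseteq> insert c U}. principal (U - K))"

end

theory Submission
  imports Defs
begin

text \<open>
  Write \<open>\<zeta> = a |z|^(2n) z^k\<close>, so that \<open>z' = z (i + \<zeta>)\<close>, and put \<open>\<gamma> = k / (2(n + k))\<close>,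
  \<open>G = \<gamma> + Im \<zeta>\<close>. Along solutions \<open>G' = 2(n + k) Re \<zeta> G\<close> and \<open>(ln |z|)' = Re \<zeta>\<close>, hence
  \<open>|z|^(2(n + k)) / G\<close> is a first integral. The period annulus is \<open>{G > 0} - {0}\<close>: on \<open>G = 0\<close> the
  argument of \<open>z\<close> would rotate at the constant speed \<open>1 - \<gamma>\<close> while \<open>Im \<zeta> = -\<gamma> < 0\<close>, which is
  impossible for a global solution.

  On \<open>G > 0\<close> let \<open>\<nu> = k / (k + 2n)\<close>, let \<open>\<phi> = k arg z + arg a\<close>, and let \<open>\<rho>\<close> be a suitable power of the
  first integral, which increases from \<open>0\<close> to \<open>\<infinity>\<close> across the annulus. Then \<open>x = (\<gamma>/G)^(1/(1 + \<nu>))\<close>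
  satisfies \<open>x - x^(-\<nu>) = -\<rho> sin \<phi>\<close>, i.e. \<open>x = X(-\<rho> sin \<phi>)\<close> for the inverse \<open>X\<close> of \<open>x - x^(-\<nu>)\<close>,
  and \<open>dt = (1 + \<nu>) X'(-\<rho> sin \<phi>) d\<phi> / k\<close>. So the period is
  \<open>T(\<rho>) = (1 + \<nu>) \<integral>_0^(2 pi) X'(\<rho> sin \<psi>) d\<psi>\<close>, and its limits are read off from
  \<open>X'(0) = 1/(1 + \<nu>)\<close>, \<open>X'(\<infinity>) = 1\<close>, \<open>X'(-\<infinity>) = 0\<close>.

  The integrand is not monotone in \<open>\<rho>\<close>, not even after pairing \<open>\<psi>\<close> with \<open>-\<psi>\<close>. But integration by parts
  gives \<open>\<rho>^2 T'(\<rho>) = -(1 + \<nu>) \<integral>_0^(2 pi) R(\<rho> sin \<psi>) sin \<psi> d\<psi>\<close> with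
  \<open>R(w) = X - w X' - w^2 X''\<close>, and \<open>R(w) > R(-w)\<close> for \<open>w > 0\<close>. In terms of \<open>y = X(w)^(1 + \<nu>)\<close> the
  function \<open>R\<close> is explicit and decreasing on \<open>y \<ge> 1\<close>; since \<open>X(w) < 1/X(-w)\<close>, it remains to see
  \<open>R(y) \<ge> R(1/y)\<close> for \<open>y \<ge> 1\<close>, which follows by comparing logarithmic derivatives.
\<close>

lemma logderiv_sum:
  fixes l y p P q :: real
  assumes "l \<noteq> 0" "y \<noteq> 0" "P \<noteq> 0" "q \<noteq> 0"
  shows "1 / y / l + p / P - 3 * (1 / q) = (P * q + l * y * (p * q - 3 * P)) / (l * y * P * q)"
  using assms by (simp add: add_divide_distrib diff_divide_distrib right_diff_distrib left_diff_distrib)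

lemma logderiv_sum_rev:
  fixes l y p P q :: real
  assumes "l \<noteq> 0" "y \<noteq> 0" "P \<noteq> 0" "q \<noteq> 0"
  shows "(1 / l - 1) * (1 / y) - p / P + 3 * (m / q)
    = ((1 - l) * P * q - p * l * y * q + 3 * m * l * y * P) / (l * y * P * q)"
  using assms by (simp add: add_divide_distrib diff_divide_distrib right_diff_distrib left_diff_distrib)

lemma sum_over_cube:
  fixes x y p P q :: real
  assumes "q \<noteq> 0"
  shows "x - x * p / q - x * m * l * p\<^sup>2 / q ^ 3 = x * (q ^ 3 - p * q\<^sup>2 - m * l * p\<^sup>2) / q ^ 3"
  using assms by (simp add: diff_divide_distrib right_diff_distrib power2_eq_square power3_eq_cube)

lemma frac_prod:
  fixes l y p P q c d s :: real
  assumes "q * q = s * y" "0 < q" "0 < P" "0 < c"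
  shows "l * q * p / d ^ 3 = l * (P * y) / (q * c ^ 3) * (s * p / P * c ^ 3 / d ^ 3)"
proof -
  have "l * (P * y) / (q * c ^ 3) * (s * p / P * c ^ 3 / d ^ 3) = l * (s * y) / q * p / d ^ 3"
    using assms(2-) by simp
  also have "\<dots> = l * q * p / d ^ 3"
    unfolding assms(1)[symmetric] using assms(2) by simp
  finally show ?thesis ..
qed

lemma pos_derivative_inverse:
  fixes S s :: "real \<Rightarrow> real"
  assumes S: "\<And>x. (S has_real_derivative s x) (at x)" and \<delta>: "0 < \<delta>" "\<And>x. \<delta> \<le> s x"
  obtains \<Theta> where "\<And>x. \<Theta> (S x) = x" "\<And>t. S (\<Theta> t) = t"
    "\<And>t. (\<Theta> has_real_derivative 1 / s (\<Theta> t)) (at t)"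
proof -
  have grow: "\<delta> * (y - x) \<le> S y - S x" if "x \<le> y" for x y
  proof -
    have "S x - \<delta> * x \<le> S y - \<delta> * y"
    proof (rule DERIV_nonneg_imp_nondecreasing[OF that])
      fix v
      have "((\<lambda>x. S x - \<delta> * x) has_real_derivative s v - \<delta>) (at v)"
        using S by (auto intro!: derivative_eq_intros)
      then show "\<exists>D. ((\<lambda>x. S x - \<delta> * x) has_real_derivative D) (at v) \<and> 0 \<le> D"
        using \<delta>(2)[of v] by (intro exI conjI) auto
    qed
    then show ?thesis by (simp add: algebra_simps)
  qed
  have cont: "isCont S x" for x using S DERIV_isCont by blast
  have mono: "S x < S y" if "x < y" for x y
    using grow[of x y] that \<delta>(1) mult_pos_pos[of \<delta> "y - x"] by linarith
  have inj: "inj S"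
    by (rule injI) (metis mono linorder_less_linear order_less_irrefl)
  have surj: "\<exists>x. S x = t" for t
  proof -
    define b where "b = \<bar>t - S 0\<bar> / \<delta>"
    have b: "0 \<le> b" "\<delta> * b = \<bar>t - S 0\<bar>" using \<delta>(1) by (auto simp: b_def)
    have "S (- b) \<le> t" "t \<le> S b"
      using grow[of 0 b] grow[of "- b" 0] b by (auto simp: algebra_simps)
    then show ?thesis using IVT[of S "- b" t b] b cont by fastforce
  qed
  define \<Theta> where "\<Theta> = inv S"
  have 1: "\<Theta> (S x) = x" for x using inj by (simp add: \<Theta>_def)
  have 2: "S (\<Theta> t) = t" for t using surj[of t] by (metis 1)
  have "isCont \<Theta> (S x)" for x
    by (rule isCont_inverse_function[where f = S and x = x and d = 1]) (auto simp: 1 cont)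
  then have "isCont \<Theta> t" for t by (metis 2)
  then have "(\<Theta> has_real_derivative inverse (s (\<Theta> t))) (at t)" for t
    using \<delta>(1) \<delta>(2)[of "\<Theta> t"]
    by (intro DERIV_inverse_function[where f = S and a = "t - 1" and b = "t + 1"]) (auto simp: 2 S)
  then show ?thesis using that[OF 1 2] by (simp add: inverse_eq_divide)
qed

lemma exp_ratio_eq:
  fixes u v :: real
  assumes "g * exp (- u) = h * exp (- v)" shows "exp u / g = exp v / h"
proof -
  have "exp u / g = inverse (g * exp (- u))" "exp v / h = inverse (h * exp (- v))"
    by (simp_all add: exp_minus divide_inverse mult.commute)
  then show ?thesis using assms by simp
qed

lemma conserved_identity:
  fixes N :: real
  assumes "\<kappa> = N * \<gamma>" "q = N - \<kappa>"
  shows "(e * (q * (e * c)) * s + e * (c * (\<kappa> * (1 + e * s)))) * E + (\<gamma> + e * s) * (E * - (N * (e * c))) = 0"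
  unfolding assms by (simp add: algebra_simps)

lemma continuous_antiderivative:
  fixes g :: "real \<Rightarrow> 'a::euclidean_space"
  assumes "\<And>x. isCont g x"
  obtains F where "\<And>x. (F has_vector_derivative g x) (at x)"
  using einterval_antiderivative[of "-\<infinity>" \<infinity> g] assms by auto

section \<open>The inverse of \<open>x - x powr (-\<mu>)\<close> and the period integral\<close>

locale trinomial =
  fixes \<mu> :: real
  assumes mu_pos: "0 < \<mu>" and mu_less_1: "\<mu> < 1"
begin

definition W :: "real \<Rightarrow> real" where
  "W x = x - x powr (-\<mu>)"

definition X :: "real \<Rightarrow> real" where
  "X w = (THE x. 0 < x \<and> W x = w)"

definition slope :: "real \<Rightarrow> real" where
  "slope x = x powr (1 + \<mu>) / (x powr (1 + \<mu>) + \<mu>)"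

definition X1 :: "real \<Rightarrow> real" where
  "X1 w = slope (X w)"

definition X2 :: "real \<Rightarrow> real" where
  "X2 w = \<mu> * (1 + \<mu>) * (X w powr (1 + \<mu>))\<^sup>2 / (X w * (X w powr (1 + \<mu>) + \<mu>) ^ 3)"

lemma W_strict_mono:
  assumes "0 < x" "x < y" shows "W x < W y"
proof -
  have "y powr (-\<mu>) \<le> x powr (-\<mu>)"
    using assms mu_pos by (intro powr_mono2') auto
  then show ?thesis using assms by (simp add: W_def)
qed

lemma W_eq: "W x = x * (x powr (1 + \<mu>) - 1) / x powr (1 + \<mu>)" if "0 < x"
  using that by (simp add: W_def field_simps powr_add powr_minus)

lemma W_has_derivative:
  assumes "0 < x"
  shows "(W has_real_derivative 1 / slope x) (at x)"
proof -
  have "(W has_real_derivative 1 + \<mu> * x powr (-\<mu> - 1)) (at x)"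
    unfolding W_def using assms by (auto intro!: derivative_eq_intros)
  moreover have "1 + \<mu> * x powr (-\<mu> - 1) = 1 / slope x"
    using assms powr_minus[of x "1 + \<mu>"] by (simp add: slope_def field_simps minus_diff_commute)
  ultimately show ?thesis by simp
qed

lemma isCont_W: "0 < x \<Longrightarrow> isCont W x"
  using W_has_derivative DERIV_isCont by blast

lemma slope_pos: "0 < x \<Longrightarrow> 0 < slope x"
  using mu_pos by (simp add: slope_def add_pos_pos)

lemma slope_less_1: "0 < x \<Longrightarrow> slope x < 1"
  using mu_pos by (simp add: slope_def add_pos_pos)

lemma W_surj: "\<exists>x>0. W x = w"
proof -
  define b where "b = \<bar>w\<bar> + 1"
  define c where "c = b powr (-1/\<mu>)"
  have b: "1 \<le> b" by (simp add: b_def)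
  have c: "0 < c" "c \<le> 1" using b mu_pos powr_mono[of "-1/\<mu>" 0 b] by (auto simp: c_def)
  have "b powr (-\<mu>) \<le> 1" using b mu_pos powr_mono[of "-\<mu>" 0 b] by auto
  then have wb: "w \<le> W b" unfolding W_def b_def by linarith
  have "c powr (-\<mu>) = b" using b mu_pos by (simp add: c_def powr_powr)
  then have wc: "W c \<le> w" using c unfolding W_def b_def by linarith
  have "\<exists>x\<ge>c. x \<le> b \<and> W x = w"
    using wb wc b c by (intro IVT) (auto intro: isCont_W)
  then show ?thesis using c(1) less_le_trans by blast
qed

lemma X_unique: "\<exists>!x. 0 < x \<and> W x = w"
  using W_surj[of w] W_strict_mono by (metis linorder_less_linear order_less_irrefl)

lemma X_pos: "0 < X w" and W_X: "W (X w) = w"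
  using theI'[OF X_unique[of w]] by (auto simp: X_def)

lemma X_neq_0: "X w \<noteq> 0"
  using X_pos[of w] by simp

lemma X_eqI: "0 < x \<Longrightarrow> W x = w \<Longrightarrow> X w = x"
  using X_unique[of w] X_pos W_X by blast

lemma X_W: "0 < x \<Longrightarrow> X (W x) = x"
  by (rule X_eqI) auto

lemma X_less_iff: "X v < X w \<longleftrightarrow> v < w"
  using W_strict_mono[OF X_pos, of v "X w"] W_strict_mono[OF X_pos, of w "X v"] W_X
  by (metis linorder_less_linear order_less_asym)

lemma X_0: "X 0 = 1"
  by (rule X_eqI) (auto simp: W_def)

lemma isCont_X: "isCont X w"
proof -
  have "isCont X (W (X w))"
  proof (rule isCont_inverse_function[where f = W and x = "X w" and d = "X w / 2"])
    show "0 < X w / 2" using X_pos by simp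
    fix z assume "\<bar>z - X w\<bar> \<le> X w / 2"
    then have "0 < z" using X_pos[of w] by argo
    then show "X (W z) = z" "isCont W z" by (auto intro: X_W isCont_W)
  qed
  then show ?thesis by (simp add: W_X)
qed

lemma X_has_derivative: "(X has_real_derivative X1 w) (at w)"
proof -
  have "(X has_real_derivative inverse (1 / slope (X w))) (at w)"
    using slope_pos[OF X_pos[of w]]
    by (intro DERIV_inverse_function[where f = W and a = "w - 1" and b = "w + 1"])
       (auto intro: W_has_derivative X_pos simp: W_X isCont_X X_neq_0)
  then show ?thesis by (simp add: X1_def)
qed

lemma X1_has_derivative: "(X1 has_real_derivative X2 w) (at w)"
proof -
  define x where "x = X w"
  define y where "y = x powr (1 + \<mu>)"
  have x: "0 < x" and y: "0 < y" using X_pos X_neq_0 by (auto simp: x_def y_def)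
  have "y + \<mu> \<noteq> 0" using y mu_pos by linarith
  have dy: "((\<lambda>x. x powr (1 + \<mu>)) has_real_derivative (1 + \<mu>) * y / x) (at x)"
    using DERIV_powr[of "\<lambda>x. x" 1 x "\<lambda>_. 1 + \<mu>" 0] x by (simp add: y_def mult.commute)
  have "(slope has_real_derivative ((1 + \<mu>) * y / x * (y + \<mu>) - y * ((1 + \<mu>) * y / x)) / ((y + \<mu>) * (y + \<mu>))) (at x)"
    unfolding slope_def[abs_def]
    using DERIV_divide[OF dy DERIV_add[OF dy DERIV_const]] \<open>y + \<mu> \<noteq> 0\<close> by (simp add: y_def)
  then have "((\<lambda>w. slope (X w)) has_real_derivative
      ((1 + \<mu>) * y / x * (y + \<mu>) - y * ((1 + \<mu>) * y / x)) / ((y + \<mu>) * (y + \<mu>)) * X1 w) (at w)"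
    unfolding x_def by (rule DERIV_chain2[OF _ X_has_derivative])
  moreover have "((1 + \<mu>) * y / x * (y + \<mu>) - y * ((1 + \<mu>) * y / x)) / ((y + \<mu>) * (y + \<mu>)) * X1 w = X2 w"
  proof -
    have "(1 + \<mu>) * y / x * (y + \<mu>) - y * ((1 + \<mu>) * y / x) = \<mu> * (1 + \<mu>) * y / x"
      by (simp add: algebra_simps add_divide_distrib)
    then show ?thesis
      unfolding X1_def X2_def slope_def x_def[symmetric] y_def[symmetric]
      by (simp add: power2_eq_square power3_eq_cube mult.assoc)
  qed
  ultimately show ?thesis by (simp add: X1_def[abs_def])
qed

lemma X1_pos: "0 < X1 w" and X1_less_1: "X1 w < 1"
  using slope_pos slope_less_1 X_pos by (auto simp: X1_def)

lemma isCont_X1: "isCont X1 w"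
  using X1_has_derivative DERIV_isCont by blast

lemma isCont_X2: "isCont X2 w"
proof -
  have "X w powr (1 + \<mu>) + \<mu> \<noteq> 0" using powr_ge_zero[of "X w" "1 + \<mu>"] mu_pos by linarith
  then show ?thesis
    unfolding X2_def[abs_def] using X_neq_0[of w]
    by (intro continuous_divide continuous_mult continuous_power continuous_add continuous_const
        continuous_powr isCont_X) auto
qed

definition P :: "real \<Rightarrow> real" where
  "P y = (1 - \<mu>) * y\<^sup>2 + 4 * \<mu> * y - \<mu> * (1 - \<mu>)"

definition P_rev :: "real \<Rightarrow> real" where
  "P_rev y = (1 - \<mu>) + 4 * \<mu> * y - \<mu> * (1 - \<mu>) * y\<^sup>2"

text \<open>\<open>R\<close> is \<open>X - w X' - w^2 X''\<close> as a function of \<open>y = X w powr (1 + \<mu>)\<close>.\<close>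
definition R :: "real \<Rightarrow> real" where
  "R y = (1 + \<mu>) * y powr (1 / (1 + \<mu>)) * P y / (y + \<mu>) ^ 3"

lemma R_eq: "X w - w * X1 w - w\<^sup>2 * X2 w = R (X w powr (1 + \<mu>))"
proof -
  define x where "x = X w"
  define y where "y = x powr (1 + \<mu>)"
  have x: "0 < x" and y: "0 < y" using X_pos X_neq_0 by (auto simp: x_def y_def)
  have ym: "y + \<mu> \<noteq> 0" using y mu_pos by linarith
  have w: "w = x * (y - 1) / y" using W_eq[OF x] by (simp add: x_def y_def W_X)
  have px: "y powr (1 / (1 + \<mu>)) = x" using x mu_pos by (simp add: y_def powr_powr)
  have e1: "w * X1 w = x * (y - 1) / (y + \<mu>)"
    unfolding X1_def slope_def x_def[symmetric] y_def[symmetric] using x y ym by (simp add: w)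
  have e2: "w\<^sup>2 * X2 w = x * \<mu> * (1 + \<mu>) * (y - 1)\<^sup>2 / (y + \<mu>) ^ 3"
    unfolding X2_def x_def[symmetric] y_def[symmetric] using x y ym
    by (simp add: w field_simps power2_eq_square)
  have e3: "x - x * (y - 1) / (y + \<mu>) - x * \<mu> * (1 + \<mu>) * (y - 1)\<^sup>2 / (y + \<mu>) ^ 3
     = x * ((y + \<mu>) ^ 3 - (y - 1) * (y + \<mu>)\<^sup>2 - \<mu> * (1 + \<mu>) * (y - 1)\<^sup>2) / (y + \<mu>) ^ 3"
    using ym by (intro sum_over_cube)
  have e4: "(y + \<mu>) ^ 3 - (y - 1) * (y + \<mu>)\<^sup>2 - \<mu> * (1 + \<mu>) * (y - 1)\<^sup>2 = (1 + \<mu>) * P y"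
    unfolding P_def by algebra
  show ?thesis
    unfolding R_def x_def[symmetric] y_def[symmetric] px e1 e2 e3 e4 by simp
qed

lemma P_pos: "0 < P y" if "1 \<le> y"
proof -
  have "\<mu> * (1 - \<mu>) < (1 - \<mu>) * 1" using mu_pos mu_less_1 by simp
  also have "\<dots> \<le> (1 - \<mu>) * y\<^sup>2" using that mu_less_1 by (intro mult_left_mono) auto
  also have "\<dots> \<le> (1 - \<mu>) * y\<^sup>2 + 4 * \<mu> * y" using that mu_pos by simp
  finally show ?thesis by (simp add: P_def)
qed

lemma P_deriv: "(P has_real_derivative 2 * (1 - \<mu>) * y + 4 * \<mu>) (at y)"
  unfolding P_def[abs_def] by (auto intro!: derivative_eq_intros)

lemma P_rev_deriv: "(P_rev has_real_derivative 4 * \<mu> - 2 * \<mu> * (1 - \<mu>) * y) (at y)"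
  unfolding P_rev_def[abs_def] by (auto intro!: derivative_eq_intros)

lemma R_antimono:
  assumes "1 \<le> y1" "y1 < y2" shows "R y2 < R y1"
proof -
  define l where "l = (\<lambda>y. ln y / (1 + \<mu>) + ln (P y) - 3 * ln (y + \<mu>))"
  have lR: "R y = (1 + \<mu>) * exp (l y)" if "1 \<le> y" for y
    using that P_pos[OF that] mu_pos
    exp_of_nat_mult[of 3 "ln (y + \<mu>)"] by (simp add: l_def R_def exp_add exp_diff powr_def)
  have "l y2 < l y1"
  proof (rule DERIV_neg_imp_decreasing_open[OF \<open>y1 < y2\<close>])
    fix y assume y: "y1 < y" "y < y2"
    then have y1: "1 < y" using assms by simp
    have Pp: "0 < P y" and ym: "0 < y + \<mu>" using P_pos[of y] y1 mu_pos by auto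
    have d: "(l has_real_derivative 1 / y / (1 + \<mu>) + (2 * (1 - \<mu>) * y + 4 * \<mu>) / P y - 3 * (1 / (y + \<mu>))) (at y)"
      unfolding l_def using y1 Pp ym mu_pos
      by (auto intro!: derivative_eq_intros P_deriv)
    define Q where "Q = (1 - \<mu>) * y\<^sup>2 + (2 + 8 * \<mu> + 2 * \<mu>\<^sup>2) * y - \<mu> * (1 - \<mu>)"
    have "Q = P y + 2 * (1 + \<mu>)\<^sup>2 * y" unfolding Q_def P_def by algebra
    then have Qp: "0 < Q" using Pp y1 mu_pos by (simp add: add_pos_pos)
    have "1 / y / (1 + \<mu>) + (2 * (1 - \<mu>) * y + 4 * \<mu>) / P y - 3 * (1 / (y + \<mu>))
      = (P y * (y + \<mu>) + (1 + \<mu>) * y * ((2 * (1 - \<mu>) * y + 4 * \<mu>) * (y + \<mu>) - 3 * P y)) / ((1 + \<mu>) * y * P y * (y + \<mu>))"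
      using y1 Pp ym mu_pos by (intro logderiv_sum) auto
    also have "P y * (y + \<mu>) + (1 + \<mu>) * y * ((2 * (1 - \<mu>) * y + 4 * \<mu>) * (y + \<mu>) - 3 * P y) = - ((y - 1) * \<mu> * Q)"
      unfolding Q_def P_def by algebra
    finally have "1 / y / (1 + \<mu>) + (2 * (1 - \<mu>) * y + 4 * \<mu>) / P y - 3 * (1 / (y + \<mu>))
      = - ((y - 1) * \<mu> * Q) / ((1 + \<mu>) * y * P y * (y + \<mu>))" .
    also have "\<dots> < 0"
      using y1 Pp ym mu_pos Qp by (intro divide_neg_pos) auto
    finally show "\<exists>D. (l has_real_derivative D) (at y) \<and> D < 0" using d by blast
  next
    have "P y \<noteq> 0" "y + \<mu> \<noteq> 0" "y \<noteq> 0" if "y \<in> {y1..y2}" for y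
      using that assms mu_pos P_pos[of y] by auto
    moreover have "continuous_on {y1..y2} P"
      unfolding P_def[abs_def] by (intro continuous_intros)
    ultimately show "continuous_on {y1..y2} l"
      unfolding l_def by (intro continuous_intros) (use mu_pos in auto)
  qed
  then show ?thesis using lR assms mu_pos by simp
qed

lemma R_inverse_le:
  assumes "1 \<le> y" shows "R (1 / y) \<le> R y"
proof (cases "0 < P_rev y")
  case False
  have "P (1 / y) = P_rev y / y\<^sup>2"
    using assms by (simp add: P_def P_rev_def field_simps power2_eq_square)
  then have "P (1 / y) \<le> 0" using False assms by (simp add: divide_nonpos_nonneg)
  then have "R (1 / y) \<le> 0" unfolding R_def
    using assms mu_pos by (intro divide_nonpos_nonneg mult_nonneg_nonpos) auto
  also have "0 \<le> R y" using P_pos[OF assms] assms mu_pos by (simp add: R_def)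
  finally show ?thesis .
next
  case True
  have P_rev_pos: "0 < P_rev v" if v: "1 \<le> v" "v \<le> y" for v
  proof -
    have one: "0 < P_rev 1"
    proof -
      have "P_rev 1 = (1 + \<mu>)\<^sup>2" by (simp add: P_rev_def power2_eq_square algebra_simps)
      then show ?thesis using mu_pos by simp
    qed
    have "(y - 1) * P_rev v = (y - v) * P_rev 1 + (v - 1) * P_rev y + \<mu> * (1 - \<mu>) * (v - 1) * (y - v) * (y - 1)"
      by (simp add: P_rev_def power2_eq_square algebra_simps)
    moreover have "0 \<le> \<mu> * (1 - \<mu>) * (v - 1) * (y - v) * (y - 1)"
      using v assms mu_pos mu_less_1 by simp
    moreover have "0 \<le> (y - v) * P_rev 1" using v one by simp
    moreover have "0 < (v - 1) * P_rev y" if "v \<noteq> 1" using v that True by simp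
    ultimately have "0 < (y - 1) * P_rev v" if "v \<noteq> 1" using that by linarith
    then show ?thesis using one v by (cases "v = 1") (auto simp: zero_less_mult_iff)
  qed
  define l where "l = (\<lambda>y. (2 / (1 + \<mu>) - 1) * ln y + ln (P y) - ln (P_rev y) + 3 * ln (1 + \<mu> * y) - 3 * ln (y + \<mu>))"
  have "l 1 \<le> l y"
  proof (rule DERIV_nonneg_imp_nondecreasing[OF assms])
    fix v assume v: "1 \<le> v" "v \<le> y"
    note Pp = P_pos[OF v(1)] and Pr = P_rev_pos[OF v]
    have ym: "0 < v + \<mu>" "0 < 1 + \<mu> * v" using v mu_pos by (auto intro: add_pos_pos)
    have d: "(l has_real_derivative (2 / (1 + \<mu>) - 1) * (1 / v) + (2 * (1 - \<mu>) * v + 4 * \<mu>) / P v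
       - (4 * \<mu> - 2 * \<mu> * (1 - \<mu>) * v) / P_rev v + 3 * (\<mu> / (1 + \<mu> * v)) - 3 * (1 / (v + \<mu>))) (at v)"
      unfolding l_def using v Pp ym Pr mu_pos
      by (auto intro!: derivative_eq_intros P_deriv P_rev_deriv)
    define Q where "Q = P v + 2 * (1 + \<mu>)\<^sup>2 * v"
    define Q' where "Q' = P_rev v + 2 * (1 + \<mu>)\<^sup>2 * v"
    have "1 / v / (1 + \<mu>) + (2 * (1 - \<mu>) * v + 4 * \<mu>) / P v - 3 * (1 / (v + \<mu>))
      = (P v * (v + \<mu>) + (1 + \<mu>) * v * ((2 * (1 - \<mu>) * v + 4 * \<mu>) * (v + \<mu>) - 3 * P v)) / ((1 + \<mu>) * v * P v * (v + \<mu>))"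
      using v Pp ym mu_pos by (intro logderiv_sum) auto
    also have "P v * (v + \<mu>) + (1 + \<mu>) * v * ((2 * (1 - \<mu>) * v + 4 * \<mu>) * (v + \<mu>) - 3 * P v) = - ((v - 1) * \<mu> * Q)"
      unfolding Q_def P_def by algebra
    finally have e1: "1 / v / (1 + \<mu>) + (2 * (1 - \<mu>) * v + 4 * \<mu>) / P v - 3 * (1 / (v + \<mu>))
      = - ((v - 1) * \<mu> * Q) / ((1 + \<mu>) * v * P v * (v + \<mu>))" .
    have "(1 / (1 + \<mu>) - 1) * (1 / v) - (4 * \<mu> - 2 * \<mu> * (1 - \<mu>) * v) / P_rev v + 3 * (\<mu> / (1 + \<mu> * v))
      = ((1 - (1 + \<mu>)) * P_rev v * (1 + \<mu> * v) - (4 * \<mu> - 2 * \<mu> * (1 - \<mu>) * v) * (1 + \<mu>) * v * (1 + \<mu> * v) + 3 * \<mu> * (1 + \<mu>) * v * P_rev v)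
         / ((1 + \<mu>) * v * P_rev v * (1 + \<mu> * v))"
      using v Pr ym mu_pos by (intro logderiv_sum_rev) auto
    also have "((1 - (1 + \<mu>)) * P_rev v * (1 + \<mu> * v) - (4 * \<mu> - 2 * \<mu> * (1 - \<mu>) * v) * (1 + \<mu>) * v * (1 + \<mu> * v) + 3 * \<mu> * (1 + \<mu>) * v * P_rev v)
       = (v - 1) * \<mu> * Q'"
      unfolding Q'_def P_rev_def by algebra
    finally have e2: "(1 / (1 + \<mu>) - 1) * (1 / v) - (4 * \<mu> - 2 * \<mu> * (1 - \<mu>) * v) / P_rev v + 3 * (\<mu> / (1 + \<mu> * v))
      = (v - 1) * \<mu> * Q' / ((1 + \<mu>) * v * P_rev v * (1 + \<mu> * v))" .
    have e3: "(2 / (1 + \<mu>) - 1) * (1 / v) = 1 / v / (1 + \<mu>) + (1 / (1 + \<mu>) - 1) * (1 / v)"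
      by (simp add: algebra_simps)
    have "Q' * P v * (v + \<mu>) - Q * P_rev v * (1 + \<mu> * v)
       = P v * P_rev v * (1 - \<mu>) * (v - 1)
         + 2 * (1 + \<mu>)\<^sup>2 * v * ((1 - \<mu>) * (1 + \<mu>\<^sup>2) * (v ^ 3 - 1) + 6 * \<mu> * (1 - \<mu>) * v * (v - 1))"
      unfolding Q_def Q'_def P_def P_rev_def by algebra
    also have "\<dots> \<ge> 0"
      using v Pp Pr mu_pos mu_less_1 one_le_power[OF v(1), of 3]
      by (intro add_nonneg_nonneg mult_nonneg_nonneg) auto
    finally have k: "Q * P_rev v * (1 + \<mu> * v) \<le> Q' * P v * (v + \<mu>)" by simp
    have "Q / (P v * (v + \<mu>)) \<le> Q' / (P_rev v * (1 + \<mu> * v))"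
      using k Pp Pr ym by (simp add: divide_simps ac_simps)
    then have "(v - 1) * \<mu> / ((1 + \<mu>) * v) * (Q / (P v * (v + \<mu>))) \<le> (v - 1) * \<mu> / ((1 + \<mu>) * v) * (Q' / (P_rev v * (1 + \<mu> * v)))"
      using v mu_pos by (intro mult_left_mono) auto
    then have "0 \<le> - ((v - 1) * \<mu> * Q) / ((1 + \<mu>) * v * P v * (v + \<mu>)) + (v - 1) * \<mu> * Q' / ((1 + \<mu>) * v * P_rev v * (1 + \<mu> * v))"
      by (simp add: ac_simps)
    then have "0 \<le> (2 / (1 + \<mu>) - 1) * (1 / v) + (2 * (1 - \<mu>) * v + 4 * \<mu>) / P v
       - (4 * \<mu> - 2 * \<mu> * (1 - \<mu>) * v) / P_rev v + 3 * (\<mu> / (1 + \<mu> * v)) - 3 * (1 / (v + \<mu>))"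
      using e1 e2 e3 by linarith
    then show "\<exists>D. (l has_real_derivative D) (at v) \<and> 0 \<le> D"
      using d by blast
  qed
  moreover have "l 1 = 0"
    by (simp add: l_def P_def P_rev_def algebra_simps)
  ultimately have l: "0 \<le> l y" by simp
  have y: "0 < y" using assms by simp
  have "P (1 / y) = P_rev y / y\<^sup>2"
    using assms by (simp add: P_def P_rev_def field_simps power2_eq_square)
  have el: "exp (l y) = y powr (2 / (1 + \<mu>) - 1) * P y / P_rev y * (1 + \<mu> * y) ^ 3 / (y + \<mu>) ^ 3"
    using y mu_pos P_pos[OF assms] True add_pos_pos[of 1 "\<mu> * y"]
      exp_of_nat_mult[of 3 "ln (y + \<mu>)"] exp_of_nat_mult[of 3 "ln (1 + \<mu> * y)"]
    by (simp add: l_def exp_add exp_diff powr_def)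
  have Ri: "R (1 / y) = (1 + \<mu>) * (P_rev y * y) / (y powr (1 / (1 + \<mu>)) * (1 + \<mu> * y) ^ 3)"
  proof -
    have "1 / y + \<mu> = (1 + \<mu> * y) / y" using y by (simp add: field_simps)
    then show ?thesis
      using y \<open>P (1 / y) = P_rev y / y\<^sup>2\<close>
      by (simp add: R_def powr_divide power_divide power2_eq_square power3_eq_cube)
  qed
  have pp: "y powr (1 / (1 + \<mu>)) * y powr (1 / (1 + \<mu>)) = y powr (2 / (1 + \<mu>) - 1) * y"
    using y by (simp add: powr_diff flip: powr_add)
  have "R y = R (1 / y) * exp (l y)"
    unfolding el Ri R_def[of y]
    by (rule frac_prod[OF pp]) (use y True mu_pos in \<open>auto intro: add_pos_pos\<close>)
  moreover have "0 \<le> R (1 / y)"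
    using True y mu_pos \<open>P (1 / y) = P_rev y / y\<^sup>2\<close> by (simp add: R_def)
  ultimately show ?thesis using l mult_left_mono[of 1 "exp (l y)" "R (1 / y)"] by simp
qed

lemma X_less_inverse:
  assumes "0 < w" shows "X w < 1 / X (- w)"
proof -
  define t where "t = 1 / X (- w)"
  have "X (- w) < 1" using X_less_iff[of "- w" 0] assms X_0 by simp
  then have t: "1 < t" using X_pos[of "- w"] by (simp add: t_def)
  have Xt: "X (- w) = 1 / t" by (simp add: t_def)
  have "W (1 / t) = - w" using W_X[of "- w"] by (simp add: Xt)
  then have w: "w = t powr \<mu> - 1 / t"
    using t by (simp add: W_def powr_minus powr_divide field_simps)
  have "t powr \<mu> < t powr 1" using t mu_less_1 by (intro powr_less_mono) auto
  moreover have "1 < t powr (1 + \<mu>)" using t mu_pos powr_less_mono[of 0 "1 + \<mu>" t] by simp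
  ultimately have "0 < (t - t powr \<mu>) * (1 - 1 / t powr (1 + \<mu>))"
    using t by (intro mult_pos_pos) auto
  also have "\<dots> = W t - w"
    using t by (simp add: w W_def powr_minus powr_add field_simps)
  finally have "X w < X (W t)" by (simp add: X_less_iff)
  also have "X (W t) = t" using t by (intro X_W) simp
  finally show ?thesis by (simp add: t_def)
qed

lemma R_gap_pos:
  assumes "0 < w" shows "R (X (- w) powr (1 + \<mu>)) < R (X w powr (1 + \<mu>))"
proof -
  define y where "y = (1 / X (- w)) powr (1 + \<mu>)"
  have "1 < X w" using X_less_iff[of 0 w] assms X_0 by simp
  then have 1: "1 \<le> X w powr (1 + \<mu>)" using mu_pos by (simp add: ge_one_powr_ge_zero)
  have 2: "X w powr (1 + \<mu>) < y"
    unfolding y_def using X_less_inverse[OF assms] X_pos[of w] mu_pos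
    by (intro powr_less_mono2) auto
  have "1 / y = X (- w) powr (1 + \<mu>)"
    using X_pos[of "- w"] by (simp add: y_def powr_divide)
  then show ?thesis using R_antimono[OF 1 2] R_inverse_le[of y] 1 2 by simp
qed

lemma continuous_on_X [continuous_intros]:
  "continuous_on S g \<Longrightarrow> continuous_on S (\<lambda>v. X (g v))"
  by (rule continuous_on_compose2[OF continuous_at_imp_continuous_on[of UNIV X]]) (auto intro: isCont_X)

lemma continuous_on_X1 [continuous_intros]:
  "continuous_on S g \<Longrightarrow> continuous_on S (\<lambda>v. X1 (g v))"
  by (rule continuous_on_compose2[OF continuous_at_imp_continuous_on[of UNIV X1]]) (auto intro: isCont_X1)

lemma continuous_on_X2 [continuous_intros]:
  "continuous_on S g \<Longrightarrow> continuous_on S (\<lambda>v. X2 (g v))"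
  by (rule continuous_on_compose2[OF continuous_at_imp_continuous_on[of UNIV X2]]) (auto intro: isCont_X2)

definition T :: "real \<Rightarrow> real" where
  "T \<rho> = (1 + \<mu>) * integral {0..pi} (\<lambda>\<psi>. X1 (\<rho> * sin \<psi>) + X1 (- (\<rho> * sin \<psi>)))"

definition T_deriv :: "real \<Rightarrow> real" where
  "T_deriv \<rho> = (1 + \<mu>) * integral {0..pi} (\<lambda>\<psi>. (X2 (\<rho> * sin \<psi>) - X2 (- (\<rho> * sin \<psi>))) * sin \<psi>)"

lemma T_has_derivative: "(T has_real_derivative T_deriv \<rho>) (at \<rho>)"
proof -
  have "((\<lambda>\<rho>. integral (cbox 0 pi) (\<lambda>\<psi>. X1 (\<rho> * sin \<psi>) + X1 (- (\<rho> * sin \<psi>)))) has_real_derivative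
      integral (cbox 0 pi) (\<lambda>\<psi>. (X2 (\<rho> * sin \<psi>) - X2 (- (\<rho> * sin \<psi>))) * sin \<psi>)) (at \<rho> within UNIV)"
  proof (rule leibniz_rule_field_derivative)
    fix \<rho> \<psi> :: real
    show "((\<lambda>\<rho>. X1 (\<rho> * sin \<psi>) + X1 (- (\<rho> * sin \<psi>))) has_real_derivative
        (X2 (\<rho> * sin \<psi>) - X2 (- (\<rho> * sin \<psi>))) * sin \<psi>) (at \<rho>)"
      by (auto intro!: derivative_eq_intros DERIV_chain2[OF X1_has_derivative] simp: algebra_simps)
    show "(\<lambda>\<psi>. X1 (\<rho> * sin \<psi>) + X1 (- (\<rho> * sin \<psi>))) integrable_on cbox 0 pi"
      by (intro integrable_continuous continuous_intros)
  next
    show "continuous_on (UNIV \<times> cbox 0 pi) (\<lambda>(\<rho>, \<psi>). (X2 (\<rho> * sin \<psi>) - X2 (- (\<rho> * sin \<psi>))) * sin \<psi>)"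
      unfolding case_prod_beta by (intro continuous_intros)
  qed auto
  then show ?thesis
    unfolding T_def[abs_def] T_deriv_def by (auto intro!: derivative_eq_intros)
qed

lemma T_deriv_eq:
  "\<rho>\<^sup>2 * T_deriv \<rho> = - (1 + \<mu>) * integral {0..pi}
     (\<lambda>\<psi>. (R (X (\<rho> * sin \<psi>) powr (1 + \<mu>)) - R (X (- (\<rho> * sin \<psi>)) powr (1 + \<mu>))) * sin \<psi>)"
proof -
  define d where "d w = X w - X (- w)" for w
  define d1 where "d1 w = X1 w + X1 (- w)" for w
  define d2 where "d2 w = X2 w - X2 (- w)" for w
  have d: "(d has_real_derivative d1 w) (at w)" for w
    unfolding d_def[abs_def] d1_def
    by (auto intro!: derivative_eq_intros DERIV_chain2[OF X_has_derivative])
  have d1: "(d1 has_real_derivative d2 w) (at w)" for w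
    unfolding d1_def[abs_def] d2_def
    by (auto intro!: derivative_eq_intros DERIV_chain2[OF X1_has_derivative])
  have R: "R (X w powr (1 + \<mu>)) - R (X (- w) powr (1 + \<mu>)) = d w - w * d1 w - w\<^sup>2 * d2 w" for w
    unfolding R_eq[symmetric] d_def d1_def d2_def by (simp add: algebra_simps)
  define F where "F \<psi> = d1 (\<rho> * sin \<psi>) * \<rho> * cos \<psi> * sin \<psi> - d (\<rho> * sin \<psi>) * cos \<psi>" for \<psi>
  have F: "(F has_real_derivative \<rho>\<^sup>2 * (d2 (\<rho> * sin \<psi>) * sin \<psi>) +
      (d (\<rho> * sin \<psi>) - (\<rho> * sin \<psi>) * d1 (\<rho> * sin \<psi>) - (\<rho> * sin \<psi>)\<^sup>2 * d2 (\<rho> * sin \<psi>)) * sin \<psi>) (at \<psi>)" for \<psi>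
  proof -
    have c: "cos \<psi> * cos \<psi> = 1 - sin \<psi> * sin \<psi>"
      using sin_cos_squared_add[of \<psi>] by (simp add: power2_eq_square)
    have "(F has_real_derivative
       (d2 (\<rho> * sin \<psi>) * (\<rho> * cos \<psi>)) * \<rho> * cos \<psi> * sin \<psi> - d1 (\<rho> * sin \<psi>) * \<rho> * sin \<psi> * sin \<psi> + d1 (\<rho> * sin \<psi>) * \<rho> * cos \<psi> * cos \<psi>
       - (d1 (\<rho> * sin \<psi>) * (\<rho> * cos \<psi>) * cos \<psi> - d (\<rho> * sin \<psi>) * sin \<psi>)) (at \<psi>)"
      unfolding F_def[abs_def]
      by (auto intro!: derivative_eq_intros DERIV_chain2[OF d] DERIV_chain2[OF d1] simp: algebra_simps)
    moreover have "(d2 (\<rho> * sin \<psi>) * (\<rho> * cos \<psi>)) * \<rho> * cos \<psi> * sin \<psi> - d1 (\<rho> * sin \<psi>) * \<rho> * sin \<psi> * sin \<psi> + d1 (\<rho> * sin \<psi>) * \<rho> * cos \<psi> * cos \<psi>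
       - (d1 (\<rho> * sin \<psi>) * (\<rho> * cos \<psi>) * cos \<psi> - d (\<rho> * sin \<psi>) * sin \<psi>)
      = \<rho>\<^sup>2 * (d2 (\<rho> * sin \<psi>) * sin \<psi>) +
      (d (\<rho> * sin \<psi>) - (\<rho> * sin \<psi>) * d1 (\<rho> * sin \<psi>) - (\<rho> * sin \<psi>)\<^sup>2 * d2 (\<rho> * sin \<psi>)) * sin \<psi>"
      using c by algebra
    ultimately show ?thesis by simp
  qed
  have cont [continuous_intros]: "continuous_on S (\<lambda>v. d (g v))" "continuous_on S (\<lambda>v. d1 (g v))" "continuous_on S (\<lambda>v. d2 (g v))"
    if "continuous_on S g" for S and g :: "real \<Rightarrow> real"
    unfolding d_def d1_def d2_def using that by (auto intro!: continuous_intros)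
  have "((\<lambda>\<psi>. \<rho>\<^sup>2 * (d2 (\<rho> * sin \<psi>) * sin \<psi>) +
      (d (\<rho> * sin \<psi>) - (\<rho> * sin \<psi>) * d1 (\<rho> * sin \<psi>) - (\<rho> * sin \<psi>)\<^sup>2 * d2 (\<rho> * sin \<psi>)) * sin \<psi>) has_integral F pi - F 0) {0..pi}"
    using F by (intro fundamental_theorem_of_calculus)
      (auto simp: has_real_derivative_iff_has_vector_derivative[symmetric] intro: DERIV_subset)
  moreover have "F pi - F 0 = 0" by (simp add: F_def d_def)
  ultimately have "integral {0..pi} (\<lambda>\<psi>. \<rho>\<^sup>2 * (d2 (\<rho> * sin \<psi>) * sin \<psi>) +
      (d (\<rho> * sin \<psi>) - (\<rho> * sin \<psi>) * d1 (\<rho> * sin \<psi>) - (\<rho> * sin \<psi>)\<^sup>2 * d2 (\<rho> * sin \<psi>)) * sin \<psi>) = 0"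
    by (simp add: integral_unique)
  then have "\<rho>\<^sup>2 * integral {0..pi} (\<lambda>\<psi>. d2 (\<rho> * sin \<psi>) * sin \<psi>) =
      - integral {0..pi} (\<lambda>\<psi>. (d (\<rho> * sin \<psi>) - (\<rho> * sin \<psi>) * d1 (\<rho> * sin \<psi>) - (\<rho> * sin \<psi>)\<^sup>2 * d2 (\<rho> * sin \<psi>)) * sin \<psi>)"
    by (subst (asm) integral_add) (auto intro!: integrable_continuous_interval continuous_intros)
  then show ?thesis
    unfolding T_deriv_def R d2_def[symmetric] by (simp add: algebra_simps)
qed

lemma T_deriv_neg:
  assumes "0 < \<rho>" shows "T_deriv \<rho> < 0"
proof -
  define h where "h \<psi> = (R (X (\<rho> * sin \<psi>) powr (1 + \<mu>)) - R (X (- (\<rho> * sin \<psi>)) powr (1 + \<mu>))) * sin \<psi>" for \<psi>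
  have pos: "0 < h \<psi>" if "0 < \<psi>" "\<psi> < pi" for \<psi>
    using R_gap_pos[of "\<rho> * sin \<psi>"] assms sin_gt_zero[OF that] by (simp add: h_def)
  have nonneg: "0 \<le> h \<psi>" if "\<psi> \<in> {0..pi}" for \<psi>
    using pos[of \<psi>] that by (cases "\<psi> = 0 \<or> \<psi> = pi") (auto simp: h_def less_imp_le)
  have cont: "continuous_on {0..pi} h"
    unfolding h_def[abs_def] R_eq[symmetric] by (intro continuous_intros)
  have "integral {0..pi} h \<noteq> 0"
    using integral_eq_0_iff[OF cont pi_gt_zero nonneg] pos[of "pi / 2"] by force
  moreover have "0 \<le> integral {0..pi} h"
    using nonneg by (intro integral_nonneg integrable_continuous_interval cont) auto
  ultimately have "0 < integral {0..pi} h" by simp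
  then have "\<rho>\<^sup>2 * T_deriv \<rho> < 0"
    unfolding T_deriv_eq h_def[symmetric] using mu_pos by (simp add: mult_neg_pos)
  then show ?thesis using assms by (simp add: mult_less_0_iff)
qed

lemma T_strict_antimono:
  assumes "0 < \<rho>1" "\<rho>1 < \<rho>2" shows "T \<rho>2 < T \<rho>1"
proof (rule DERIV_neg_imp_decreasing[OF assms(2)])
  fix \<rho> assume "\<rho>1 \<le> \<rho>"
  then show "\<exists>D. (T has_real_derivative D) (at \<rho>) \<and> D < 0"
    using assms(1) T_has_derivative T_deriv_neg[of \<rho>] by (intro exI[of _ "T_deriv \<rho>"]) auto
qed

lemma T_0: "T 0 = 2 * pi"
  using mu_pos by (simp add: T_def X1_def X_0 slope_def)

lemma X_at_top: "filterlim X at_top at_top"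
  unfolding filterlim_at_top eventually_at_top_linorder
proof
  fix Z :: real
  define b where "b = max Z 1"
  have "Z \<le> X w" if "W b \<le> w" for w
  proof -
    have "\<not> X w < X (W b)" using that by (simp add: X_less_iff)
    moreover have "X (W b) = b" by (intro X_W) (simp add: b_def)
    ultimately show ?thesis by (simp add: b_def)
  qed
  then show "\<exists>N. \<forall>w\<ge>N. Z \<le> X w" by blast
qed

lemma X_at_bot: "(X \<longlongrightarrow> 0) at_bot"
proof (rule order_tendstoI)
  fix c :: real assume "c < 0"
  then have "c < X w" for w using X_pos[of w] by linarith
  then show "eventually (\<lambda>w. c < X w) at_bot" by simp
next
  fix c :: real assume "0 < c"
  then have "X w < c" if "w < W c" for w using X_less_iff[of w "W c"] that by (simp add: X_W)
  then show "eventually (\<lambda>w. X w < c) at_bot"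
    using eventually_at_bot_dense by blast
qed

lemma X1_at_top: "(X1 \<longlongrightarrow> 1) at_top"
proof -
  have "((\<lambda>w. 1 / (1 + \<mu> * X w powr (- (1 + \<mu>)))) \<longlongrightarrow> 1 / (1 + \<mu> * 0)) at_top"
    using mu_pos by (intro tendsto_intros tendsto_neg_powr X_at_top) auto
  moreover have "1 / (1 + \<mu> * X w powr (- (1 + \<mu>))) = X1 w" for w
    unfolding X1_def slope_def powr_minus using X_pos[of w] by (simp add: field_simps X_neq_0)
  ultimately show ?thesis by simp
qed

lemma X1_at_bot: "(X1 \<longlongrightarrow> 0) at_bot"
proof -
  have "((\<lambda>w. X w powr (1 + \<mu>) / (X w powr (1 + \<mu>) + \<mu>)) \<longlongrightarrow> 0 / (0 + \<mu>)) at_bot"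
    using mu_pos X_pos
    by (intro tendsto_intros tendsto_zero_powrI[where b = "1 + \<mu>"] X_at_bot)
      (auto intro: always_eventually less_imp_le)
  then show ?thesis by (simp add: X1_def[abs_def] slope_def)
qed

lemma T_at_top: "(T \<longlongrightarrow> (1 + \<mu>) * pi) at_top"
proof (rule tendsto_at_topI_sequentially)
  fix \<rho> :: "nat \<Rightarrow> real" assume \<rho>: "filterlim \<rho> at_top sequentially"
  define f where "f j \<psi> = X1 (\<rho> j * sin \<psi>) + X1 (- (\<rho> j * sin \<psi>))" for j \<psi>
  have "(\<lambda>j. integral {0<..<pi} (f j)) \<longlonglongrightarrow> integral {0<..<pi} (\<lambda>_. 1)"
  proof (rule dominated_convergence(2))
    show "f j integrable_on {0<..<pi}" for j
      unfolding f_def[abs_def] integrable_on_open_interval_real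
      by (intro integrable_continuous_interval continuous_intros)
    show "(\<lambda>_. 2 :: real) integrable_on {0<..<pi}"
      unfolding integrable_on_open_interval_real by (intro integrable_continuous_interval continuous_intros)
    show "norm (f j \<psi>) \<le> 2" for j \<psi>
      using X1_pos[of "\<rho> j * sin \<psi>"] X1_pos[of "- (\<rho> j * sin \<psi>)"] X1_less_1[of "\<rho> j * sin \<psi>"] X1_less_1[of "- (\<rho> j * sin \<psi>)"]
      unfolding f_def real_norm_def by linarith
  next
    fix \<psi> :: real assume "\<psi> \<in> {0<..<pi}"
    then have s: "0 < sin \<psi>" by (simp add: sin_gt_zero)
    have top: "filterlim (\<lambda>j. \<rho> j * sin \<psi>) at_top sequentially"
      using filterlim_at_top_mult_tendsto_pos[OF tendsto_const s \<rho>] .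
    then have bot: "filterlim (\<lambda>j. - (\<rho> j * sin \<psi>)) at_bot sequentially"
      by (simp add: filterlim_uminus_at_bot)
    show "(\<lambda>j. f j \<psi>) \<longlonglongrightarrow> 1"
      unfolding f_def
      using tendsto_add[OF filterlim_compose[OF X1_at_top top] filterlim_compose[OF X1_at_bot bot]] by simp
  qed
  then have "(\<lambda>j. integral {0..pi} (f j)) \<longlonglongrightarrow> pi"
    by (simp flip: integral_open_interval_real)
  then show "(\<lambda>j. T (\<rho> j)) \<longlonglongrightarrow> (1 + \<mu>) * pi"
    unfolding T_def f_def[symmetric] by (intro tendsto_intros)
qed

text \<open>Along an orbit with invariant \<open>\<rho>\<close>, the antiderivative \<open>S\<close> evaluated at the angle \<open>\<phi>\<close> is \<open>k\<close> times the elapsed time.\<close>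
lemma clock_exists:
  obtains S where "\<And>\<phi>. (S has_real_derivative (1 + \<mu>) * X1 (- (\<rho> * sin \<phi>))) (at \<phi>)"
proof -
  have "isCont (\<lambda>\<phi>. (1 + \<mu>) * X1 (- (\<rho> * sin \<phi>))) \<phi>" for \<phi>
    by (intro continuous_intros isCont_o2[OF _ isCont_X1])
  then show ?thesis
    using continuous_antiderivative that
    unfolding has_real_derivative_iff_has_vector_derivative by blast
qed

lemma clock_period:
  assumes S: "\<And>\<phi>. (S has_real_derivative (1 + \<mu>) * X1 (- (\<rho> * sin \<phi>))) (at \<phi>)"
  shows "S (\<phi> + 2 * pi) = S \<phi> + T \<rho>"
proof -
  have shift: "((\<lambda>\<phi>. S (\<phi> + c)) has_real_derivative (1 + \<mu>) * X1 (- (\<rho> * sin (\<phi> + c)))) (at \<phi>)" for \<phi> c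
    using DERIV_shift[of S _ \<phi> c] S by blast
  have "((\<lambda>\<phi>. S (\<phi> + 2 * pi) - S \<phi>) has_real_derivative 0) (at \<phi>)" for \<phi>
    using DERIV_diff[OF shift[of "2 * pi" \<phi>] S[of \<phi>]] by simp
  then have "S (\<phi> + 2 * pi) - S \<phi> = S (0 + 2 * pi) - S 0"
    by (rule DERIV_isconst_all[of "\<lambda>\<phi>. S (\<phi> + 2 * pi) - S \<phi>", rule_format])
  also have "\<dots> = T \<rho>"
  proof -
    have "((\<lambda>\<phi>. S \<phi> + S (\<phi> + pi)) has_real_derivative
        (1 + \<mu>) * (X1 (\<rho> * sin \<phi>) + X1 (- (\<rho> * sin \<phi>)))) (at \<phi>)" for \<phi>
      using DERIV_add[OF S[of \<phi>] shift[of pi \<phi>]] by (simp add: algebra_simps)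
    then have "((\<lambda>\<phi>. (1 + \<mu>) * (X1 (\<rho> * sin \<phi>) + X1 (- (\<rho> * sin \<phi>)))) has_integral
        (S pi + S (pi + pi)) - (S 0 + S (0 + pi))) {0..pi}"
      by (intro fundamental_theorem_of_calculus)
        (auto simp: has_real_derivative_iff_has_vector_derivative[symmetric] intro: DERIV_subset)
    from integral_unique[OF this] show ?thesis by (simp add: T_def)
  qed
  finally show ?thesis by simp
qed

lemma clock_int_period:
  assumes "\<And>\<phi>. (S has_real_derivative (1 + \<mu>) * X1 (- (\<rho> * sin \<phi>))) (at \<phi>)"
  shows "S (\<phi> + 2 * pi * of_int j) = S \<phi> + of_int j * T \<rho>"
proof (induction j rule: int_induct[where k = 0])
  case base
  then show ?case by simp
next
  case (step1 i)
  then show ?case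
    using clock_period[OF assms, of "\<phi> + 2 * pi * of_int i"] by (simp add: algebra_simps)
next
  case (step2 i)
  then show ?case
    using clock_period[OF assms, of "\<phi> + 2 * pi * of_int (i - 1)"] by (simp add: algebra_simps)
qed

lemma X1_lower_bound:
  obtains \<delta> where "0 < \<delta>" "\<And>\<phi>. \<delta> \<le> (1 + \<mu>) * X1 (- (\<rho> * sin \<phi>))"
proof -
  have "\<exists>w0\<in>{- \<bar>\<rho>\<bar>..\<bar>\<rho>\<bar>}. \<forall>w\<in>{- \<bar>\<rho>\<bar>..\<bar>\<rho>\<bar>}. X1 w0 \<le> X1 w"
    by (intro continuous_attains_inf compact_Icc continuous_on_X1 continuous_on_id) auto
  then obtain w0 where w0: "\<And>w. w \<in> {- \<bar>\<rho>\<bar>..\<bar>\<rho>\<bar>} \<Longrightarrow> X1 w0 \<le> X1 w" by blast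
  have "(1 + \<mu>) * X1 w0 \<le> (1 + \<mu>) * X1 (- (\<rho> * sin \<phi>))" for \<phi>
  proof -
    have "\<bar>\<rho> * sin \<phi>\<bar> \<le> \<bar>\<rho>\<bar>"
      using mult_left_mono[OF abs_sin_le_one[of \<phi>], of "\<bar>\<rho>\<bar>"] by (simp add: abs_mult)
    then show ?thesis using mu_pos by (intro mult_left_mono w0) auto
  qed
  then show ?thesis using that X1_pos[of w0] mu_pos by (metis add_pos_pos mult_pos_pos zero_less_one)
qed

lemma T_pos: "0 < T \<rho>"
proof -
  obtain S where S: "\<And>\<phi>. (S has_real_derivative (1 + \<mu>) * X1 (- (\<rho> * sin \<phi>))) (at \<phi>)"
    using clock_exists by blast
  have "S 0 < S (0 + 2 * pi)"
  proof (rule DERIV_pos_imp_increasing[of 0 "0 + 2 * pi" S])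
    fix \<phi> :: real
    have "0 < (1 + \<mu>) * X1 (- (\<rho> * sin \<phi>))" using X1_pos mu_pos by simp
    then show "\<exists>D. (S has_real_derivative D) (at \<phi>) \<and> 0 < D" using S by blast
  next
    show "0 < 0 + 2 * pi" by simp
  qed
  then show ?thesis using clock_period[OF S, of 0] by simp
qed

end

section \<open>The differential equation\<close>

locale center_ode =
  fixes n k :: nat and a :: complex
  assumes n_pos: "0 < n" and k_pos: "0 < k" and a_nonzero: "a \<noteq> 0"
begin

definition \<nu> :: real where "\<nu> = real k / real (k + 2 * n)"

definition \<gamma> :: real where "\<gamma> = real k / real (2 * (n + k))"

sublocale trinomial \<nu>
  using n_pos k_pos by unfold_locales (auto simp: \<nu>_def)

definition f :: "complex \<Rightarrow> complex" where
  "f z = \<i> * z + a * (z * cnj z) ^ n * z ^ (k + 1)"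

definition \<zeta> :: "complex \<Rightarrow> complex" where
  "\<zeta> z = a * of_real (cmod z ^ (2 * n)) * z ^ k"

definition G :: "complex \<Rightarrow> real" where
  "G z = \<gamma> + Im (\<zeta> z)"

definition rho :: "complex \<Rightarrow> real" where
  "rho z = cmod a * \<gamma> powr (- \<gamma>) * (cmod z ^ (2 * (n + k)) / G z) powr (1 / (1 + \<nu>))"

lemma gamma_pos: "0 < \<gamma>" and gamma_less_1: "\<gamma> < 1"
  using n_pos k_pos by (auto simp: \<gamma>_def)

lemma one_plus_nu: "1 + \<nu> = real (2 * (n + k)) / real (k + 2 * n)"
  using k_pos by (simp add: \<nu>_def field_simps)

lemma gamma_eq: "\<gamma> = \<nu> / (1 + \<nu>)"
  unfolding one_plus_nu using k_pos by (simp add: \<gamma>_def \<nu>_def)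

lemma one_minus_gamma: "1 / (1 + \<nu>) = 1 - \<gamma>"
  using mu_pos by (simp add: gamma_eq field_simps)

lemma f_eq: "f z = z * (\<i> + \<zeta> z)"
proof -
  have "(z * cnj z) ^ n = of_real (cmod z ^ (2 * n))"
    by (simp only: complex_norm_square[symmetric] of_real_power[symmetric] power_mult)
  then show ?thesis by (simp add: f_def \<zeta>_def algebra_simps)
qed

lemma cmod_polar_power: "cmod (of_real (exp l) * cis \<theta>) ^ j = exp (real j * l)"
  by (simp add: norm_mult exp_of_nat_mult)

lemma zeta_polar:
  "\<zeta> (of_real (exp l) * cis \<theta>) = of_real (cmod a * exp (real (k + 2 * n) * l)) * cis (real k * \<theta> + Arg a)"
proof -
  have a: "a = of_real (cmod a) * cis (Arg a)"
    using rcis_cmod_Arg[of a] by (simp add: rcis_def)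
  have "(of_real (exp l) * cis \<theta>) ^ k = of_real (exp (real k * l)) * cis (real k * \<theta>)"
    by (simp add: power_mult_distrib Complex.DeMoivre exp_of_nat_mult)
  then have "\<zeta> (of_real (exp l) * cis \<theta>)
      = a * of_real (exp (real (2 * n) * l)) * (of_real (exp (real k * l)) * cis (real k * \<theta>))"
    by (simp only: \<zeta>_def cmod_polar_power)
  also have "\<dots> = of_real (cmod a) * cis (Arg a) * of_real (exp (real (2 * n) * l)) * (of_real (exp (real k * l)) * cis (real k * \<theta>))"
    using a by argo
  also have "\<dots> = of_real (cmod a * (exp (real k * l) * exp (real (2 * n) * l))) * (cis (real k * \<theta>) * cis (Arg a))"
    by (simp only: of_real_mult mult_ac)
  also have "exp (real k * l) * exp (real (2 * n) * l) = exp (real (k + 2 * n) * l)"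
    by (simp add: distrib_right exp_add)
  finally show ?thesis by (simp only: cis_mult)
qed

lemma continuous_zeta: "continuous_on S \<zeta>"
  unfolding \<zeta>_def[abs_def] by (intro continuous_intros)

lemma continuous_G: "continuous_on S G"
  unfolding G_def[abs_def] by (intro continuous_intros continuous_zeta)

text \<open>Every solution equals \<open>p exp(\<integral>(i + \<zeta>))\<close>, so it has a global polar lift and no uniqueness theorem is needed.\<close>
lemma solution_lift:
  assumes y: "ode_solution f y" and y0: "y 0 = of_real r0 * cis \<theta>0" and r0: "0 < r0"
  obtains l \<theta> where "\<And>t. y t = of_real (exp (l t)) * cis (\<theta> t)" "l 0 = ln r0" "\<theta> 0 = \<theta>0"
    "\<And>t. (l has_real_derivative Re (\<zeta> (y t))) (at t)"
    "\<And>t. (\<theta> has_real_derivative 1 + Im (\<zeta> (y t))) (at t)"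
proof -
  have yd: "(y has_vector_derivative y t * (\<i> + \<zeta> (y t))) (at t)" for t
    using y by (simp add: ode_solution_def f_eq)
  then have yc: "isCont y t" for t
    using has_vector_derivative_continuous by blast
  have "isCont (\<lambda>t. \<i> + \<zeta> (y t)) t" for t
    using continuous_zeta[of UNIV] yc
    by (intro continuous_intros isCont_o2[OF yc]) (simp add: continuous_on_eq_continuous_at)
  then obtain F where F: "\<And>t. (F has_vector_derivative \<i> + \<zeta> (y t)) (at t)"
    using continuous_antiderivative by metis
  define L where "L t = F t - F 0" for t
  have L: "(L has_vector_derivative \<i> + \<zeta> (y t)) (at t)" for t
    unfolding L_def[abs_def] using F by (auto intro!: derivative_eq_intros)
  have e: "((\<lambda>t. exp (- L t)) has_vector_derivative - (\<i> + \<zeta> (y t)) * exp (- L t)) (at t)" for t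
    using field_vector_diff_chain_at[OF has_vector_derivative_minus[OF L[of t]] DERIV_exp]
    by (simp add: o_def)
  have "((\<lambda>t. y t * exp (- L t)) has_vector_derivative 0) (at t)" for t
    using has_vector_derivative_mult[OF yd[of t] e[of t]] by (simp add: algebra_simps)
  then obtain c where c: "\<And>t. y t * exp (- L t) = c"
    using has_vector_derivative_zero_constant[of UNIV "\<lambda>t. y t * exp (- L t)"] by auto
  have "y t * exp (- L t) = y 0 * exp (- L 0)" for t
    unfolding c ..
  then have yL: "y t = y 0 * exp (L t)" for t
    by (metis L_def diff_self exp_zero minus_zero mult.assoc mult.right_neutral exp_minus_inverse mult.commute)
  show ?thesis
  proof (rule that[of "\<lambda>t. ln r0 + Re (L t)" "\<lambda>t. \<theta>0 + Im (L t)"])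
    fix t
    show "y t = of_real (exp (ln r0 + Re (L t))) * cis (\<theta>0 + Im (L t))"
      using r0 by (simp add: yL[of t] y0 exp_add exp_eq_polar[of "L t"] cis_mult[symmetric] exp_of_real)
    have "((\<lambda>t. Re (L t)) has_real_derivative Re (\<i> + \<zeta> (y t))) (at t)"
      "((\<lambda>t. Im (L t)) has_real_derivative Im (\<i> + \<zeta> (y t))) (at t)"
      unfolding has_real_derivative_iff_has_vector_derivative
      using bounded_linear.has_vector_derivative[OF bounded_linear_Re L]
        bounded_linear.has_vector_derivative[OF bounded_linear_Im L] by auto
    then show "((\<lambda>t. ln r0 + Re (L t)) has_real_derivative Re (\<zeta> (y t))) (at t)"
      "((\<lambda>t. \<theta>0 + Im (L t)) has_real_derivative 1 + Im (\<zeta> (y t))) (at t)"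
      using DERIV_add[OF DERIV_const] by fastforce+
  qed (auto simp: L_def)
qed

lemma polar_solution:
  assumes l: "\<And>t. (l has_real_derivative Re (\<zeta> (of_real (exp (l t)) * cis (\<theta> t)))) (at t)"
    and \<theta>: "\<And>t. (\<theta> has_real_derivative 1 + Im (\<zeta> (of_real (exp (l t)) * cis (\<theta> t)))) (at t)"
  shows "ode_solution f (\<lambda>t. of_real (exp (l t)) * cis (\<theta> t))"
proof -
  have eq: "of_real (exp (l t)) * cis (\<theta> t) = exp (of_real (l t) + \<i> * of_real (\<theta> t))" for t
    by (simp add: exp_eq_polar)
  have "((\<lambda>t. of_real (exp (l t)) * cis (\<theta> t)) has_vector_derivative f (of_real (exp (l t)) * cis (\<theta> t))) (at t)" for t
  proof -
    define \<zeta>' where "\<zeta>' = \<zeta> (of_real (exp (l t)) * cis (\<theta> t))"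
    have "((\<lambda>t. of_real (l t) + \<i> * of_real (\<theta> t)) has_vector_derivative
        of_real (Re \<zeta>') + \<i> * of_real (1 + Im \<zeta>')) (at t)"
      using l[of t] \<theta>[of t]
      by (auto intro!: derivative_eq_intros simp: \<zeta>'_def has_real_derivative_iff_has_vector_derivative)
    from field_vector_diff_chain_at[OF this DERIV_exp]
    have "((\<lambda>t. of_real (exp (l t)) * cis (\<theta> t)) has_vector_derivative
        (of_real (Re \<zeta>') + \<i> * of_real (1 + Im \<zeta>')) * (of_real (exp (l t)) * cis (\<theta> t))) (at t)"
      unfolding o_def eq .
    moreover have "of_real (Re \<zeta>') + \<i> * of_real (1 + Im \<zeta>') = \<i> + \<zeta>'"
      by (simp add: complex_eq_iff)
    ultimately show ?thesis by (simp add: f_eq \<zeta>'_def mult.commute)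
  qed
  then show ?thesis by (simp add: ode_solution_def)
qed

lemma lift_conserved:
  assumes y: "\<And>t. y t = of_real (exp (l t)) * cis (\<theta> t)"
    and l: "\<And>t. (l has_real_derivative Re (\<zeta> (y t))) (at t)"
    and \<theta>: "\<And>t. (\<theta> has_real_derivative 1 + Im (\<zeta> (y t))) (at t)"
  shows "G (y t) * exp (- (real (2 * (n + k)) * l t)) = G (y 0) * exp (- (real (2 * (n + k)) * l 0))"
proof -
  define e where "e t = cmod a * exp (real (k + 2 * n) * l t)" for t
  define \<phi> where "\<phi> t = real k * \<theta> t + Arg a" for t
  have z: "Re (\<zeta> (y t)) = e t * cos (\<phi> t)" "Im (\<zeta> (y t)) = e t * sin (\<phi> t)" for t
    unfolding y zeta_polar e_def \<phi>_def by simp_all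
  have ed: "(e has_real_derivative e t * (real (k + 2 * n) * (e t * cos (\<phi> t)))) (at t)" for t
    unfolding e_def[abs_def] using l[of t] unfolding z e_def
    by (auto intro!: derivative_eq_intros)
  have pd: "(\<phi> has_real_derivative k * (1 + e t * sin (\<phi> t))) (at t)" for t
    unfolding \<phi>_def[abs_def] using \<theta>[of t] unfolding z \<phi>_def
    by (auto intro!: derivative_eq_intros)
  have ld: "(l has_real_derivative e t * cos (\<phi> t)) (at t)" for t using l[of t] by (simp add: z)
  have G: "G (y t) = \<gamma> + e t * sin (\<phi> t)" for t by (simp add: G_def z)
  have kg: "real k = real (2 * (n + k)) * \<gamma>" using k_pos by (simp add: \<gamma>_def)
  have "((\<lambda>t. (\<gamma> + e t * sin (\<phi> t)) * exp (- (real (2 * (n + k)) * l t))) has_real_derivative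
      (e t * (real (k + 2 * n) * (e t * cos (\<phi> t))) * sin (\<phi> t) + e t * (cos (\<phi> t) * (k * (1 + e t * sin (\<phi> t)))))
         * exp (- (real (2 * (n + k)) * l t))
      + (\<gamma> + e t * sin (\<phi> t)) * (exp (- (real (2 * (n + k)) * l t)) * - (real (2 * (n + k)) * (e t * cos (\<phi> t))))) (at t)" for t
    by (auto intro!: derivative_eq_intros ed pd ld simp: algebra_simps)
  moreover have "(e t * (real (k + 2 * n) * (e t * cos (\<phi> t))) * sin (\<phi> t) + e t * (cos (\<phi> t) * (k * (1 + e t * sin (\<phi> t)))))
         * exp (- (real (2 * (n + k)) * l t))
      + (\<gamma> + e t * sin (\<phi> t)) * (exp (- (real (2 * (n + k)) * l t)) * - (real (2 * (n + k)) * (e t * cos (\<phi> t)))) = 0" for t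
    using kg by (rule conserved_identity) simp
  ultimately have "((\<lambda>t. G (y t) * exp (- (real (2 * (n + k)) * l t))) has_real_derivative 0) (at t)" for t
    unfolding G by metis
  then show ?thesis
    by (rule DERIV_isconst_all[rule_format])
qed

lemma rho_pos: "0 < G z \<Longrightarrow> z \<noteq> 0 \<Longrightarrow> 0 < rho z"
  using a_nonzero gamma_pos by (simp add: rho_def)

lemma rho_polar:
  assumes G: "0 < G z" and z: "z = of_real (exp l) * cis \<theta>"
  shows "\<gamma> * rho z / X (- (rho z * sin (real k * \<theta> + Arg a))) = cmod a * exp (real (k + 2 * n) * l)"
proof -
  define e where "e = cmod a * exp (real (k + 2 * n) * l)"
  define x where "x = (\<gamma> / G z) powr (1 / (1 + \<nu>))"
  have x: "0 < x" using G gamma_pos by (simp add: x_def)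
  have Gz: "G z = \<gamma> + e * sin (real k * \<theta> + Arg a)"
    unfolding G_def z zeta_polar e_def by simp
  have r: "rho z = e * x / \<gamma>"
  proof -
    have "cmod z ^ (2 * (n + k)) = exp (real (2 * (n + k)) * l)"
      unfolding z by (rule cmod_polar_power)
    moreover have "exp (real (2 * (n + k)) * l) powr (1 / (1 + \<nu>)) = exp (real (k + 2 * n) * l)"
      unfolding powr_def one_plus_nu using k_pos by simp
    moreover have "x = \<gamma> powr (1 - \<gamma>) / G z powr (1 / (1 + \<nu>))"
      unfolding x_def using G gamma_pos by (simp add: powr_divide one_minus_gamma)
    ultimately show ?thesis
      unfolding rho_def e_def using G gamma_pos by (simp add: powr_divide powr_diff powr_minus field_simps)
  qed
  have "x powr (1 + \<nu>) = \<gamma> / G z"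
    using G gamma_pos mu_pos by (simp add: x_def powr_powr)
  then have "W x = x * (1 - G z / \<gamma>)"
    using G gamma_pos x by (simp add: W_eq field_simps)
  also have "\<dots> = - (rho z * sin (real k * \<theta> + Arg a))"
    unfolding r Gz using gamma_pos by (simp add: field_simps)
  finally have "X (- (rho z * sin (real k * \<theta> + Arg a))) = x" using X_W[OF x] by simp
  then show ?thesis using x gamma_pos by (simp add: r e_def)
qed

lemma clock_rate: "1 / ((1 + \<nu>) * X1 w) = 1 - \<gamma> * w / X w"
proof -
  define y where "y = X w powr (1 + \<nu>)"
  have y: "0 < y" using X_pos[of w] by (simp add: y_def)
  have "w / X w = (y - 1) / y"
    using W_eq[OF X_pos[of w]] X_pos[of w] by (simp add: W_X y_def field_simps)
  then have "1 - \<gamma> * w / X w = 1 - \<nu> / (1 + \<nu>) * ((y - 1) / y)"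
    unfolding gamma_eq by (metis times_divide_eq_right)
  also have "\<dots> = ((1 + \<nu>) * y - \<nu> * (y - 1)) / ((1 + \<nu>) * y)"
    using y mu_pos by (simp add: diff_divide_distrib right_diff_distrib)
  also have "(1 + \<nu>) * y - \<nu> * (y - 1) = y + \<nu>"
    by (simp add: algebra_simps)
  finally show ?thesis unfolding X1_def slope_def y_def[symmetric] by simp
qed

lemma solution_clock:
  assumes y: "\<And>t. y t = of_real (exp (l t)) * cis (\<theta> t)"
    and l: "\<And>t. (l has_real_derivative Re (\<zeta> (y t))) (at t)"
    and \<theta>: "\<And>t. (\<theta> has_real_derivative 1 + Im (\<zeta> (y t))) (at t)"
    and G0: "0 < G (y 0)"
    and S: "\<And>\<phi>. (S has_real_derivative (1 + \<nu>) * X1 (- (rho (y 0) * sin \<phi>))) (at \<phi>)"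
  shows "S (real k * \<theta> t + Arg a) = S (real k * \<theta> 0 + Arg a) + real k * t"
proof -
  have cons: "G (y t) * exp (- (real (2 * (n + k)) * l t)) = G (y 0) * exp (- (real (2 * (n + k)) * l 0))" for t
    by (rule lift_conserved[OF y l \<theta>])
  have Gpos: "0 < G (y t)" for t
    using cons[of t] G0 by (metis exp_gt_zero zero_less_mult_pos2 mult_pos_pos)
  have norm: "cmod (y t) ^ (2 * (n + k)) = exp (real (2 * (n + k)) * l t)" for t
    unfolding y by (rule cmod_polar_power)
  have "cmod (y t) ^ (2 * (n + k)) / G (y t) = cmod (y 0) ^ (2 * (n + k)) / G (y 0)" for t
    unfolding norm by (rule exp_ratio_eq[OF cons])
  then have rho: "rho (y t) = rho (y 0)" for t
    unfolding rho_def by metis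
  have rate: "(1 + \<nu>) * X1 (- (rho (y 0) * sin (real k * \<theta> t + Arg a))) * (1 + Im (\<zeta> (y t))) = 1" for t
  proof -
    have "\<gamma> * rho (y 0) / X (- (rho (y 0) * sin (real k * \<theta> t + Arg a))) = cmod a * exp (real (k + 2 * n) * l t)"
      using rho_polar[OF Gpos y, of t] unfolding rho[of t] .
    moreover have "1 + Im (\<zeta> (y t)) = 1 + cmod a * exp (real (k + 2 * n) * l t) * sin (real k * \<theta> t + Arg a)"
      unfolding y zeta_polar by simp
    moreover have "1 - \<gamma> * - (\<rho> * s) / x = 1 + \<gamma> * \<rho> / x * s" for \<rho> s x :: real
      by simp
    ultimately have "1 + Im (\<zeta> (y t)) = 1 / ((1 + \<nu>) * X1 (- (rho (y 0) * sin (real k * \<theta> t + Arg a))))"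
      unfolding clock_rate by metis
    then show ?thesis
      using X1_pos[of "- (rho (y 0) * sin (real k * \<theta> t + Arg a))"] mu_pos by simp
  qed
  have "((\<lambda>t. S (real k * \<theta> t + Arg a) - real k * t) has_real_derivative 0) (at t)" for t
  proof -
    have "((\<lambda>t. S (real k * \<theta> t + Arg a)) has_real_derivative
       (1 + \<nu>) * X1 (- (rho (y 0) * sin (real k * \<theta> t + Arg a))) * (k * (1 + Im (\<zeta> (y t))))) (at t)"
      by (rule DERIV_chain2[OF S]) (auto intro!: derivative_eq_intros \<theta>)
    moreover have "(1 + \<nu>) * X1 (- (rho (y 0) * sin (real k * \<theta> t + Arg a))) * (k * (1 + Im (\<zeta> (y t)))) = k"
      using rate[of t] by (metis mult.left_commute mult.right_neutral)
    ultimately have "((\<lambda>t. S (real k * \<theta> t + Arg a)) has_real_derivative real k) (at t)" by simp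
    from DERIV_diff[OF this DERIV_cmult[OF DERIV_ident, of "real k"]] show ?thesis by simp
  qed
  then have "S (real k * \<theta> t + Arg a) - real k * t = S (real k * \<theta> 0 + Arg a) - real k * 0"
    by (rule DERIV_isconst_all[of "\<lambda>t. S (real k * \<theta> t + Arg a) - real k * t", rule_format])
  then show ?thesis by simp
qed

lemma solution_exists:
  assumes G: "0 < G p" and p: "p \<noteq> 0"
  obtains l \<theta> where "ode_solution f (\<lambda>t. of_real (exp (l t)) * cis (\<theta> t))"
    "of_real (exp (l 0)) * cis (\<theta> 0) = p"
    "\<And>t. (l has_real_derivative Re (\<zeta> (of_real (exp (l t)) * cis (\<theta> t)))) (at t)"
    "\<And>t. (\<theta> has_real_derivative 1 + Im (\<zeta> (of_real (exp (l t)) * cis (\<theta> t)))) (at t)"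
    "\<And>s t. \<theta> t = \<theta> s + 2 * pi \<Longrightarrow> of_real (exp (l t)) * cis (\<theta> t) = of_real (exp (l s)) * cis (\<theta> s)"
    "\<exists>t. \<theta> t = \<theta> 0 + 2 * pi"
proof -
  define \<rho> where "\<rho> = rho p"
  define m where "m = real (k + 2 * n)"
  have m: "0 < m" using k_pos by (simp add: m_def)
  have \<rho>: "0 < \<rho>" using rho_pos[OF G p] by (simp add: \<rho>_def)
  have ca: "0 < cmod a" using a_nonzero by simp
  obtain S where S: "\<And>\<phi>. (S has_real_derivative (1 + \<nu>) * X1 (- (\<rho> * sin \<phi>))) (at \<phi>)"
    using clock_exists by blast
  obtain \<delta> where \<delta>: "0 < \<delta>" "\<And>\<phi>. \<delta> \<le> (1 + \<nu>) * X1 (- (\<rho> * sin \<phi>))"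
    using X1_lower_bound by blast
  define K where "K \<theta> = S (real k * \<theta> + Arg a) / k" for \<theta>
  have K: "(K has_real_derivative (1 + \<nu>) * X1 (- (\<rho> * sin (real k * \<theta> + Arg a)))) (at \<theta>)" for \<theta>
    unfolding K_def[abs_def] using k_pos
    by (auto intro!: derivative_eq_intros DERIV_chain2[OF S])
  obtain \<Theta> where \<Theta>: "\<And>x. \<Theta> (K x) = x" "\<And>t. K (\<Theta> t) = t"
    "\<And>t. (\<Theta> has_real_derivative 1 / ((1 + \<nu>) * X1 (- (\<rho> * sin (real k * \<Theta> t + Arg a))))) (at t)"
    using pos_derivative_inverse[OF K \<delta>] by blast
  define \<theta> where "\<theta> t = \<Theta> (t + K (Arg p))" for t
  define x where "x t = X (- (\<rho> * sin (real k * \<theta> t + Arg a)))" for t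
  define l where "l t = (ln (\<gamma> * \<rho> / cmod a) - ln (x t)) / m" for t
  define y where "y t = of_real (exp (l t)) * cis (\<theta> t)" for t
  have x: "0 < x t" for t by (simp add: x_def X_pos)
  have \<theta>': "(\<theta> has_real_derivative 1 / ((1 + \<nu>) * X1 (- (\<rho> * sin (real k * \<theta> t + Arg a))))) (at t)" for t
    unfolding \<theta>_def[abs_def] using \<Theta>(3)[of "t + K (Arg p)"] by (simp add: DERIV_shift)
  have e: "cmod a * exp (real (k + 2 * n) * l t) = \<gamma> * \<rho> / x t" for t
    unfolding l_def m_def[symmetric] using m x[of t] \<rho> gamma_pos ca by (simp add: exp_diff)
  have \<zeta>: "Re (\<zeta> (y t)) = \<gamma> * \<rho> / x t * cos (real k * \<theta> t + Arg a)"
    "Im (\<zeta> (y t)) = \<gamma> * \<rho> / x t * sin (real k * \<theta> t + Arg a)" for t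
    unfolding y_def zeta_polar e by simp_all
  have \<theta>d: "(\<theta> has_real_derivative 1 + Im (\<zeta> (y t))) (at t)" for t
    using \<theta>'[of t] unfolding clock_rate \<zeta> x_def by (simp add: mult.assoc)
  have ld: "(l has_real_derivative Re (\<zeta> (y t))) (at t)" for t
  proof -
    define X1' where "X1' = X1 (- (\<rho> * sin (real k * \<theta> t + Arg a)))"
    have X1': "0 < X1'" by (simp add: X1'_def X1_pos)
    have xd: "(x has_real_derivative X1' * (- (\<rho> * (cos (real k * \<theta> t + Arg a) * (k * (1 / ((1 + \<nu>) * X1'))))))) (at t)"
      unfolding x_def[abs_def] X1'_def
      by (rule DERIV_chain2[OF X_has_derivative]) (auto intro!: derivative_eq_intros \<theta>')
    have "(l has_real_derivative - (1 / x t * (X1' * (- (\<rho> * (cos (real k * \<theta> t + Arg a) * (k * (1 / ((1 + \<nu>) * X1')))))))) / m) (at t)"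
      unfolding l_def[abs_def] using x[of t] m by (auto intro!: derivative_eq_intros xd)
    moreover have "- (1 / x t * (X1' * (- (\<rho> * (cos (real k * \<theta> t + Arg a) * (k * (1 / ((1 + \<nu>) * X1')))))))) / m
        = real k / m / (1 + \<nu>) * \<rho> / x t * cos (real k * \<theta> t + Arg a)"
      using X1' by (simp add: mult_ac)
    moreover have "real k / m / (1 + \<nu>) = \<gamma>"
      by (simp add: gamma_eq \<nu>_def m_def)
    ultimately show ?thesis unfolding \<zeta> by metis
  qed
  have \<theta>0: "\<theta> 0 = Arg p" by (simp add: \<theta>_def \<Theta>)
  have p_polar: "p = of_real (exp (ln (cmod p))) * cis (Arg p)"
    using p rcis_cmod_Arg[of p] by (simp add: rcis_def)
  have "cmod a * exp (m * ln (cmod p)) = \<gamma> * \<rho> / x 0"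
    using rho_polar[OF G p_polar] by (simp add: x_def \<theta>0 \<rho>_def m_def)
  then have "cmod a * exp (m * ln (cmod p)) = cmod a * exp (m * l 0)"
    using e[of 0, folded m_def] by (rule trans[OF _ sym])
  then have "exp (m * ln (cmod p)) = exp (m * l 0)" using ca by (metis less_irrefl mult_left_cancel)
  then have l0: "l 0 = ln (cmod p)" using m by simp
  show ?thesis
  proof (rule that[of l \<theta>])
    show "ode_solution f (\<lambda>t. of_real (exp (l t)) * cis (\<theta> t))"
      by (rule polar_solution) (use ld \<theta>d in \<open>auto simp: y_def\<close>)
    show "of_real (exp (l 0)) * cis (\<theta> 0) = p"
      using p_polar by (simp add: l0 \<theta>0)
    show "(l has_real_derivative Re (\<zeta> (of_real (exp (l t)) * cis (\<theta> t)))) (at t)" for t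
      using ld by (simp add: y_def)
    show "(\<theta> has_real_derivative 1 + Im (\<zeta> (of_real (exp (l t)) * cis (\<theta> t)))) (at t)" for t
      using \<theta>d by (simp add: y_def)
    show "\<exists>t. \<theta> t = \<theta> 0 + 2 * pi"
      by (rule exI[of _ "K (Arg p + 2 * pi) - K (Arg p)"]) (simp add: \<theta>0, simp add: \<theta>_def \<Theta>)
    fix s t assume st: "\<theta> t = \<theta> s + 2 * pi"
    have "real k * \<theta> t + Arg a = (real k * \<theta> s + Arg a) + 2 * pi * of_int (int k)"
      by (simp add: st algebra_simps)
    then have "sin (real k * \<theta> t + Arg a) = sin (real k * \<theta> s + Arg a)"
      using sin_cos_eq_iff by blast
    then have "l t = l s" by (simp add: l_def x_def)
    then show "of_real (exp (l t)) * cis (\<theta> t) = of_real (exp (l s)) * cis (\<theta> s)"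
      by (simp add: st flip: cis_mult)
  qed
qed

lemma return_time:
  assumes G: "0 < G p" and p: "p \<noteq> 0"
  shows "\<exists>y. ode_solution f y \<and> y 0 = p \<and> y (T (rho p)) = p"
    and "ode_solution f y \<Longrightarrow> y 0 = p \<Longrightarrow> y t = p \<Longrightarrow> 0 < t \<Longrightarrow> T (rho p) \<le> t"
proof -
  obtain S where S: "\<And>\<phi>. (S has_real_derivative (1 + \<nu>) * X1 (- (rho p * sin \<phi>))) (at \<phi>)"
    using clock_exists by blast
  have shift: "t = of_int j * T (rho p)"
    if "S (real k * (\<theta> + 2 * pi * of_int j) + Arg a) = S (real k * \<theta> + Arg a) + real k * t" for \<theta> t j
  proof -
    have "real k * (\<theta> + 2 * pi * of_int j) + Arg a = (real k * \<theta> + Arg a) + 2 * pi * of_int (int k * j)"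
      by (simp add: algebra_simps)
    then have "S (real k * (\<theta> + 2 * pi * of_int j) + Arg a) = S (real k * \<theta> + Arg a) + of_int (int k * j) * T (rho p)"
      by (simp only: clock_int_period[OF S])
    then have "real k * t = of_int (int k * j) * T (rho p)"
      using that by linarith
    then show ?thesis using k_pos by simp
  qed
  show "\<exists>y. ode_solution f y \<and> y 0 = p \<and> y (T (rho p)) = p"
  proof -
    obtain l \<theta> where *: "ode_solution f (\<lambda>t. of_real (exp (l t)) * cis (\<theta> t))"
      "of_real (exp (l 0)) * cis (\<theta> 0) = p"
      "\<And>t. (l has_real_derivative Re (\<zeta> (of_real (exp (l t)) * cis (\<theta> t)))) (at t)"
      "\<And>t. (\<theta> has_real_derivative 1 + Im (\<zeta> (of_real (exp (l t)) * cis (\<theta> t)))) (at t)"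
      "\<And>s t. \<theta> t = \<theta> s + 2 * pi \<Longrightarrow> of_real (exp (l t)) * cis (\<theta> t) = of_real (exp (l s)) * cis (\<theta> s)"
      "\<exists>t. \<theta> t = \<theta> 0 + 2 * pi"
      using solution_exists[OF assms] by blast
    obtain t where t: "\<theta> t = \<theta> 0 + 2 * pi" using *(6) by blast
    have "S (real k * \<theta> t + Arg a) = S (real k * \<theta> 0 + Arg a) + real k * t"
      by (rule solution_clock[where y = "\<lambda>t. of_real (exp (l t)) * cis (\<theta> t)" and l = l])
        (use * G S in auto)
    then have "t = T (rho p)" using shift[of "\<theta> 0" 1 t] t by simp
    then show ?thesis using *(1,2) *(5)[OF t] by (intro exI[of _ "\<lambda>t. of_real (exp (l t)) * cis (\<theta> t)"]) simp
  qed
  assume y: "ode_solution f y" "y 0 = p" "y t = p" "0 < t"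
  have "y 0 = of_real (cmod p) * cis (Arg p)"
    using rcis_cmod_Arg[of p] y by (simp add: rcis_def)
  then obtain l \<theta> where *: "\<And>t. y t = of_real (exp (l t)) * cis (\<theta> t)"
    "\<And>t. (l has_real_derivative Re (\<zeta> (y t))) (at t)"
    "\<And>t. (\<theta> has_real_derivative 1 + Im (\<zeta> (y t))) (at t)"
    using solution_lift[OF y(1)] p by (metis zero_less_norm_iff)
  have clock: "S (real k * \<theta> t + Arg a) = S (real k * \<theta> 0 + Arg a) + real k * t"
    by (rule solution_clock[OF *]) (use y G S in auto)
  have eq: "of_real (exp (l t)) * cis (\<theta> t) = of_real (exp (l 0)) * cis (\<theta> 0)"
    using y *(1) by metis
  then have "cmod (of_real (exp (l t)) * cis (\<theta> t)) = cmod (of_real (exp (l 0)) * cis (\<theta> 0))" by simp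
  then have "exp (l t) = exp (l 0)" by (simp add: norm_mult)
  then have "cis (\<theta> t) = cis (\<theta> 0)" using eq by simp
  then have "sin (\<theta> t) = sin (\<theta> 0) \<and> cos (\<theta> t) = cos (\<theta> 0)"
    by (simp add: complex_eq_iff)
  then obtain j :: int where j: "\<theta> t = \<theta> 0 + 2 * pi * j" using sin_cos_eq_iff by blast
  then have t: "t = of_int j * T (rho p)" using shift[of "\<theta> 0" j t] clock by simp
  then have "0 < of_int j * T (rho p)" using y by simp
  then have "0 < j" using T_pos[of "rho p"] by (simp add: zero_less_mult_iff)
  then have "1 * T (rho p) \<le> of_int j * T (rho p)"
    using T_pos[of "rho p"] by (intro mult_right_mono) auto
  then show "T (rho p) \<le> t" using t by simp
qed

lemma f_nonzero:
  assumes "0 < G p" "p \<noteq> 0" shows "f p \<noteq> 0"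
proof
  assume "f p = 0"
  then have "Im (\<i> + \<zeta> p) = 0" using assms by (simp add: f_eq)
  then show False using assms gamma_less_1 by (simp add: G_def)
qed

lemma periodic_point_if: "0 < G p \<Longrightarrow> p \<noteq> 0 \<Longrightarrow> periodic_point f p"
  unfolding periodic_point_def using f_nonzero return_time(1) T_pos by blast

lemma period_eq:
  assumes "0 < G p" "p \<noteq> 0" shows "period f p = T (rho p)"
  unfolding period_def
  by (rule cInf_eq_minimum) (use return_time[OF assms] T_pos in auto)

lemma not_periodic_if:
  assumes "G p = 0" shows "\<not> periodic_point f p"
proof
  assume "periodic_point f p"
  then obtain y where y: "ode_solution f y" "y 0 = p" and "f p \<noteq> 0"
    unfolding periodic_point_def by blast
  have p: "p \<noteq> 0" using \<open>f p \<noteq> 0\<close> by (auto simp: f_eq)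
  have "y 0 = of_real (cmod p) * cis (Arg p)"
    using rcis_cmod_Arg[of p] y by (simp add: rcis_def)
  then obtain l \<theta> where *: "\<And>t. y t = of_real (exp (l t)) * cis (\<theta> t)"
    "\<And>t. (l has_real_derivative Re (\<zeta> (y t))) (at t)"
    "\<And>t. (\<theta> has_real_derivative 1 + Im (\<zeta> (y t))) (at t)"
    using solution_lift[OF y(1)] p by (metis zero_less_norm_iff)
  have "G (y t) = 0" for t
    using lift_conserved[OF *, of t] assms y by simp
  then have Im: "Im (\<zeta> (y t)) = - \<gamma>" for t unfolding G_def by (simp add: eq_neg_iff_add_eq_0 add.commute)
  have "((\<lambda>t. \<theta> t - (1 - \<gamma>) * t) has_real_derivative 0) (at t)" for t
    using *(3)[of t] unfolding Im by (auto intro!: derivative_eq_intros)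
  then have \<theta>: "\<theta> t - (1 - \<gamma>) * t = \<theta> 0 - (1 - \<gamma>) * 0" for t
    by (rule DERIV_isconst_all[of "\<lambda>t. \<theta> t - (1 - \<gamma>) * t", rule_format])
  define t where "t = ((pi / 2 - Arg a) / k - \<theta> 0) / (1 - \<gamma>)"
  have "\<theta> t = (pi / 2 - Arg a) / k"
    using \<theta>[of t] gamma_less_1 by (simp add: t_def)
  then have "real k * \<theta> t + Arg a = pi / 2" using k_pos by simp
  then have "Im (\<zeta> (y t)) = cmod a * exp (real (k + 2 * n) * l t)"
    unfolding *(1)[of t] zeta_polar by (simp del: add_divide_eq_if_simps eq_divide_eq_numeral1)
  then show False using Im[of t] gamma_pos by (smt (verit) exp_gt_zero norm_ge_zero mult_nonneg_nonneg)
qed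

lemma G_0: "G 0 = \<gamma>"
  using k_pos by (simp add: G_def \<zeta>_def)

lemma zeta_scale: "0 \<le> u \<Longrightarrow> \<zeta> (of_real u * z) = of_real (u ^ (k + 2 * n)) * \<zeta> z"
  by (simp add: \<zeta>_def norm_mult power_mult_distrib power_add)

lemma period_annulus_eq: "period_annulus f 0 = {z. z \<noteq> 0 \<and> 0 < G z}"
proof (intro equalityI subsetI)
  fix z assume "z \<in> period_annulus f 0"
  then obtain U where U: "0 \<notin> U" "connected (insert 0 U)" "\<And>p. p \<in> U \<Longrightarrow> periodic_point f p" "z \<in> U"
    unfolding period_annulus_def by blast
  have "0 < G z"
  proof (rule ccontr)
    assume "\<not> 0 < G z"
    moreover have "connected (G ` insert 0 U)"
      using U(2) continuous_G by (rule connected_continuous_image[rotated])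
    moreover have "G z \<in> G ` insert 0 U" "G 0 \<in> G ` insert 0 U" using U(4) by blast+
    ultimately have "0 \<in> G ` insert 0 U"
      using gamma_pos unfolding connected_iff_interval G_0 by (meson less_imp_le not_less)
    then obtain p where "p \<in> insert 0 U" "G p = 0" by (metis imageE)
    then show False using U(3) not_periodic_if G_0 gamma_pos by auto
  qed
  then show "z \<in> {z. z \<noteq> 0 \<and> 0 < G z}" using U by auto
next
  fix z assume z: "z \<in> {z. z \<noteq> 0 \<and> 0 < G z}"
  have ins: "insert 0 {z. z \<noteq> 0 \<and> 0 < G z} = {z. 0 < G z}"
    using G_0 gamma_pos by auto
  have "open {z. 0 < G z}"
    using continuous_G by (intro open_Collect_less continuous_on_const)
  moreover have "starlike {z. 0 < G z}"
    unfolding starlike_def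
  proof (intro bexI[of _ 0] ballI subsetI)
    fix x w assume x: "x \<in> {z. 0 < G z}" and "w \<in> closed_segment 0 x"
    then obtain u where u: "0 \<le> u" "u \<le> 1" and w: "w = of_real u * x"
      by (auto simp: in_segment scaleR_conv_of_real)
    have Gw: "G w = \<gamma> + u ^ (k + 2 * n) * Im (\<zeta> x)"
      unfolding G_def w zeta_scale[OF u(1)] by (simp del: of_real_power)
    have u': "0 \<le> u ^ (k + 2 * n)" "u ^ (k + 2 * n) \<le> 1"
      using u by (auto intro: power_le_one)
    have "0 < G w"
    proof (cases "0 \<le> Im (\<zeta> x)")
      case True
      then show ?thesis unfolding Gw using u' gamma_pos by (simp add: add_pos_nonneg)
    next
      case False
      then have "1 * Im (\<zeta> x) \<le> u ^ (k + 2 * n) * Im (\<zeta> x)"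
        using u' by (intro mult_right_mono_neg) auto
      then show ?thesis using x unfolding Gw by (simp add: G_def)
    qed
    then show "w \<in> {z. 0 < G z}" by simp
  qed (use G_0 gamma_pos in auto)
  ultimately show "z \<in> period_annulus f 0"
    unfolding period_annulus_def using z ins periodic_point_if
    by (intro UnionI[of "{z. z \<noteq> 0 \<and> 0 < G z}"]) (auto simp: starlike_imp_connected)
qed

lemma is_center_0: "is_center f 0"
proof -
  have "open {z. 0 < G z}"
    using continuous_G by (intro open_Collect_less continuous_on_const)
  moreover have "0 \<in> {z. 0 < G z}" using G_0 gamma_pos by simp
  ultimately obtain r where "0 < r" "ball 0 r \<subseteq> {z. 0 < G z}"
    using open_contains_ball by metis
  then show ?thesis
    unfolding is_center_def using periodic_point_if by (auto simp: f_eq intro!: exI[of _ r])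
qed

lemma rho_ray_mono:
  assumes "0 < s1" "s1 < s2" "0 < G (of_real s1 * cis \<theta>)" "0 < G (of_real s2 * cis \<theta>)"
  shows "rho (of_real s1 * cis \<theta>) < rho (of_real s2 * cis \<theta>)"
proof -
  define b where "b = Im (\<zeta> (cis \<theta>))"
  define m where "m = k + 2 * n"
  have G: "G (of_real s * cis \<theta>) = \<gamma> + s ^ m * b" if "0 < s" for s
    using that by (simp add: G_def zeta_scale b_def m_def del: of_real_power)
  have g: "0 < \<gamma> + s1 ^ m * b" "0 < \<gamma> + s2 ^ m * b" using assms G by auto
  have "s1 ^ m < s2 ^ m" using assms k_pos by (intro power_strict_mono) (auto simp: m_def)
  then have "s1 ^ m * (\<gamma> + s2 ^ m * b) < s2 ^ m * (\<gamma> + s1 ^ m * b)"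
    using gamma_pos by (simp add: algebra_simps)
  then have "s1 ^ m / (\<gamma> + s1 ^ m * b) < s2 ^ m / (\<gamma> + s2 ^ m * b)"
    using g by (simp add: divide_simps mult.commute)
  moreover have "s1 ^ k < s2 ^ k" using assms k_pos by (intro power_strict_mono) auto
  ultimately have "s1 ^ k * (s1 ^ m / (\<gamma> + s1 ^ m * b)) < s2 ^ k * (s2 ^ m / (\<gamma> + s2 ^ m * b))"
    using assms g by (intro mult_strict_mono) auto
  moreover have "s ^ (2 * (n + k)) = s ^ k * s ^ m" for s :: real
    by (simp add: m_def flip: power_add) (simp add: algebra_simps)
  ultimately have "s1 ^ (2 * (n + k)) / (\<gamma> + s1 ^ m * b) < s2 ^ (2 * (n + k)) / (\<gamma> + s2 ^ m * b)"
    by simp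
  then have "(s1 ^ (2 * (n + k)) / (\<gamma> + s1 ^ m * b)) powr (1 / (1 + \<nu>))
      < (s2 ^ (2 * (n + k)) / (\<gamma> + s2 ^ m * b)) powr (1 / (1 + \<nu>))"
    using assms g mu_pos by (intro powr_less_mono2) auto
  then show ?thesis
    unfolding rho_def using assms a_nonzero gamma_pos by (simp add: G norm_mult)
qed

lemma period_tendsto_center: "(period f \<longlongrightarrow> 2 * pi) (at 0 within period_annulus f 0)"
proof -
  let ?F = "at 0 within period_annulus f 0"
  have in_A: "eventually (\<lambda>z. z \<noteq> 0 \<and> 0 < G z) ?F"
    unfolding eventually_at_filter period_annulus_eq by simp
  have "((\<lambda>z. cmod z ^ (2 * (n + k)) / G z) \<longlongrightarrow> cmod 0 ^ (2 * (n + k)) / G 0) ?F"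
    using gamma_pos continuous_G[of UNIV]
    by (intro tendsto_intros)
      (auto simp: G_0[symmetric] continuous_on_eq_continuous_at intro: isCont_tendsto_compose[of 0 G])
  then have "((\<lambda>z. cmod z ^ (2 * (n + k)) / G z) \<longlongrightarrow> 0) ?F"
    using k_pos by (simp add: power_0_left)
  moreover have "eventually (\<lambda>z. 0 \<le> cmod z ^ (2 * (n + k)) / G z) ?F"
    using in_A by eventually_elim simp
  ultimately have "((\<lambda>z. (cmod z ^ (2 * (n + k)) / G z) powr (1 / (1 + \<nu>))) \<longlongrightarrow> 0) ?F"
    using mu_pos by (intro tendsto_zero_powrI[where b = "1 / (1 + \<nu>)"] tendsto_const) auto
  then have "(rho \<longlongrightarrow> cmod a * \<gamma> powr (- \<gamma>) * 0) ?F"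
    unfolding rho_def[abs_def] by (intro tendsto_mult tendsto_const)
  then have "(rho \<longlongrightarrow> 0) ?F" by simp
  then have "((\<lambda>z. T (rho z)) \<longlongrightarrow> T 0) ?F"
    by (rule isCont_tendsto_compose[OF DERIV_isCont[OF T_has_derivative]])
  moreover have "eventually (\<lambda>z. T (rho z) = period f z) ?F"
    using in_A by eventually_elim (simp add: period_eq)
  ultimately show ?thesis using T_0 by (simp add: tendsto_cong)
qed

lemma compact_sublevel: "compact {z. cmod z ^ (2 * (n + k)) \<le> C * G z}" if C: "0 < C"
  unfolding compact_eq_bounded_closed
proof
  show "closed {z. cmod z ^ (2 * (n + k)) \<le> C * G z}"
    by (intro closed_Collect_le continuous_intros continuous_G)
  show "bounded {z. cmod z ^ (2 * (n + k)) \<le> C * G z}"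
  proof (rule boundedI)
    fix z assume "z \<in> {z. cmod z ^ (2 * (n + k)) \<le> C * G z}"
    then have le: "cmod z ^ (2 * (n + k)) \<le> C * G z" by simp
    show "cmod z \<le> max 1 (C * (\<gamma> + cmod a))"
    proof (cases "cmod z \<le> 1")
      case False
      then have z: "1 \<le> cmod z" by simp
      have "cmod z ^ k * cmod z ^ (k + 2 * n) = cmod z ^ (2 * (n + k))"
        by (simp flip: power_add) (simp add: algebra_simps)
      also note le
      also have "G z \<le> (\<gamma> + cmod a) * cmod z ^ (k + 2 * n)"
      proof -
        have "Im (\<zeta> z) \<le> cmod (\<zeta> z)" using abs_Im_le_cmod[of "\<zeta> z"] by linarith
        also have "\<dots> = cmod a * cmod z ^ (k + 2 * n)"
          by (simp add: \<zeta>_def norm_mult norm_power power_add)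
        finally have "Im (\<zeta> z) \<le> cmod a * cmod z ^ (k + 2 * n)" .
        moreover have "\<gamma> * 1 \<le> \<gamma> * cmod z ^ (k + 2 * n)"
          using z gamma_pos by (intro mult_left_mono one_le_power) auto
        ultimately show ?thesis by (simp add: G_def algebra_simps)
      qed
      then have "C * G z \<le> C * ((\<gamma> + cmod a) * cmod z ^ (k + 2 * n))"
        using C by (intro mult_left_mono) auto
      finally have "cmod z ^ k * cmod z ^ (k + 2 * n) \<le> C * (\<gamma> + cmod a) * cmod z ^ (k + 2 * n)"
        by (simp add: mult.assoc)
      then have "cmod z ^ k \<le> C * (\<gamma> + cmod a)"
        using zero_less_power[of "cmod z" "k + 2 * n"] z by (subst (asm) mult_le_cancel_right_pos) linarith+
      moreover have "cmod z ^ 1 \<le> cmod z ^ k"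
        using z k_pos by (intro power_increasing) auto
      ultimately show ?thesis by simp
    qed simp
  qed
qed

lemma rho_at_outer_boundary: "filterlim rho at_top (approach_outer_boundary (period_annulus f 0) 0)"
proof (subst filterlim_at_top_gt[where c = 0], intro allI impI)
  fix Z :: real assume Z: "0 < Z"
  define c where "c = cmod a * \<gamma> powr (- \<gamma>)"
  have c: "0 < c" using a_nonzero gamma_pos by (simp add: c_def)
  define C where "C = (Z / c) powr (1 + \<nu>)"
  define K where "K = {z. cmod z ^ (2 * (n + k)) \<le> C * G z}"
  have C: "0 < C" using Z c by (simp add: C_def)
  have "0 < G z" if "z \<in> K" for z
  proof (rule ccontr)
    assume "\<not> 0 < G z"
    then have "C * G z \<le> 0" using C by (simp add: mult_nonneg_nonpos)
    then have "cmod z ^ (2 * (n + k)) \<le> 0" using that unfolding K_def by simp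
    moreover have "0 \<le> cmod z ^ (2 * (n + k))" by simp
    ultimately have "cmod z ^ (2 * (n + k)) = 0" by linarith
    then have "z = 0" by simp
    then show False using \<open>\<not> 0 < G z\<close> G_0 gamma_pos by simp
  qed
  then have K: "K \<in> {K. compact K \<and> K \<subseteq> insert 0 (period_annulus f 0)}"
    using compact_sublevel[OF C] by (auto simp: K_def period_annulus_eq)
  have "Z \<le> rho z" if "z \<in> period_annulus f 0 - K" for z
  proof -
    have z: "z \<noteq> 0" "0 < G z" "C * G z < cmod z ^ (2 * (n + k))"
      using that by (auto simp: K_def period_annulus_eq)
    then have "C \<le> cmod z ^ (2 * (n + k)) / G z" by (simp add: field_simps)
    then have "C powr (1 / (1 + \<nu>)) \<le> (cmod z ^ (2 * (n + k)) / G z) powr (1 / (1 + \<nu>))"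
      using C mu_pos by (intro powr_mono2) auto
    moreover have "C powr (1 / (1 + \<nu>)) = Z / c"
      using Z c mu_pos by (simp add: C_def powr_powr)
    ultimately have "Z / c \<le> (cmod z ^ (2 * (n + k)) / G z) powr (1 / (1 + \<nu>))" by simp
    then show ?thesis unfolding rho_def c_def[symmetric] using c by (simp add: field_simps)
  qed
  then have "eventually (\<lambda>z. Z \<le> rho z) (principal (period_annulus f 0 - K))"
    by (simp add: eventually_principal)
  then show "eventually (\<lambda>z. Z \<le> rho z) (approach_outer_boundary (period_annulus f 0) 0)"
    unfolding approach_outer_boundary_def using K by (rule eventually_INF1[rotated])
qed

lemma period_tendsto_outer_boundary:
  "(period f \<longlongrightarrow> (1 + \<nu>) * pi) (approach_outer_boundary (period_annulus f 0) 0)"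
proof -
  let ?F = "approach_outer_boundary (period_annulus f 0) 0"
  have "eventually (\<lambda>z. z \<in> period_annulus f 0) (principal (period_annulus f 0 - {}))"
    by (simp add: eventually_principal)
  then have "eventually (\<lambda>z. z \<in> period_annulus f 0) ?F"
    unfolding approach_outer_boundary_def by (rule eventually_INF1[rotated]) simp
  then have "eventually (\<lambda>z. T (rho z) = period f z) ?F"
    by eventually_elim (simp add: period_annulus_eq period_eq)
  moreover have "((\<lambda>z. T (rho z)) \<longlongrightarrow> (1 + \<nu>) * pi) ?F"
    by (rule filterlim_compose[OF T_at_top rho_at_outer_boundary])
  ultimately show ?thesis by (simp add: tendsto_cong)
qed

end

theorem theoremA:
  fixes n k :: nat and a :: complex
  assumes "n > 0" and "k > 0" and "a \<noteq> 0"
  defines "f \<equiv> (\<lambda>z. \<i> * z + a * (z * cnj z) ^ n * z ^ (k + 1))"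
  shows "is_center f 0
    \<and> (\<forall>\<theta>::real. \<forall>s1 s2. 0 < s1 \<and> s1 < s2
          \<and> complex_of_real s1 * cis \<theta> \<in> period_annulus f 0
          \<and> complex_of_real s2 * cis \<theta> \<in> period_annulus f 0
          \<longrightarrow> period f (complex_of_real s2 * cis \<theta>) < period f (complex_of_real s1 * cis \<theta>))
    \<and> (period f \<longlongrightarrow> 2 * pi) (at 0 within period_annulus f 0)
    \<and> (period f \<longlongrightarrow> 2 * real (k + n) * pi / real (k + 2 * n))
        (approach_outer_boundary (period_annulus f 0) 0)"
proof -
  interpret C: center_ode n k a
    using assms by unfold_locales
  have f: "f = C.f"
    by (simp add: f_def C.f_def fun_eq_iff)
  have lim: "(1 + C.\<nu>) * pi = 2 * real (k + n) * pi / real (k + 2 * n)"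
    unfolding C.one_plus_nu by (simp add: algebra_simps)
  have "period C.f (complex_of_real s2 * cis \<theta>) < period C.f (complex_of_real s1 * cis \<theta>)"
    if "0 < s1" "s1 < s2" "complex_of_real s1 * cis \<theta> \<in> period_annulus C.f 0"
      "complex_of_real s2 * cis \<theta> \<in> period_annulus C.f 0" for \<theta> s1 s2
  proof -
    have G: "0 < C.G (complex_of_real s1 * cis \<theta>)" "0 < C.G (complex_of_real s2 * cis \<theta>)"
      using that by (auto simp: C.period_annulus_eq)
    have nz: "complex_of_real s1 * cis \<theta> \<noteq> 0" "complex_of_real s2 * cis \<theta> \<noteq> 0"
      using that by (auto simp: C.period_annulus_eq)
    show ?thesis
      unfolding C.period_eq[OF G(1) nz(1)] C.period_eq[OF G(2) nz(2)]
      using C.rho_pos[OF G(1) nz(1)] C.rho_ray_mono[OF that(1,2) G] by (rule C.T_strict_antimono)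
  qed
  then show ?thesis
    unfolding f using C.is_center_0 C.period_tendsto_center C.period_tendsto_outer_boundary
    unfolding lim by blast
qed

end
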